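(* Define integers $a(n)$ and $b(n)$ for $n\ge 0$ by $$\sum_{n=0}^{\infty}a(n)x^n=\prod_{n=1}^{\infty}(1-x^n)^8,\qquad \sum_{n=0}^{\infty}b(n)x^n=\prod_{n=1}^{\infty}\frac{(1-x^{3n})^3}{1-x^n}.$$ Then for every integer $n\ge 0$, $a(n)=0$ if and only if $b(n)=0$. Moreover, $a(n)=b(n)=0$ holds precisely for those non-negative integers $n$ for which $\operatorname{ord}_p(3n+1)$ is odd for some prime $p\equiv 2\pmod 3$.
   Context: For a prime $p$ and a nonzero integer $N$, $\operatorname{ord}_p(N)$ denotes the exponent of the highest power of $p$ dividing $N$. ($b(n)$ equals the number of $3$-core partitions of $n$.) *)

theory Defs
  imports
    "HOL-Analysis.Infinite_Products"
    "HOL-Computational_Algebra.Formal_Power_Series"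
    "HOL-Number_Theory.Cong"
begin

text \<open>
  The infinite products are taken in the \<open>X\<close>-adic metric on \<^typ>\<open>rat fps\<close>, with the
  library operator \<^const>\<open>prodinf\<close>, which is indexed from 0; hence \<open>Suc n\<close> where the
  mathematical index starts at 1. Rational coefficients are used because the library's division
  of formal power series needs an \<open>inverse\<close> on the coefficients. As \<^const>\<open>prodinf\<close> is
  unspecified for divergent products, we check that both products converge, and that they have
  integer coefficients, so that the integer sequences they define exist.
\<close>

lemma fps_has_prod_Ints:
  fixes f :: "nat \<Rightarrow> rat fps"
  assumes one: "\<And>n k. k \<le> n \<Longrightarrow> fps_nth (f n) k = (if k = 0 then 1 else 0)"
    and int: "\<And>n k. fps_nth (f n) k \<in> \<int>"
  shows "\<exists>c :: nat \<Rightarrow> int. f has_prod Abs_fps (\<lambda>n. of_int (c n))"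
proof -
  define P where "P m = (\<Prod>i\<le>m. f i)" for m
  have P_Suc: "P (Suc m) = P m * f (Suc m)" for m
    by (simp add: P_def)
  have step: "fps_nth (P (Suc m)) k = fps_nth (P m) k" if "k \<le> m" for m k
  proof -
    have "fps_nth (P (Suc m)) k = (\<Sum>i=0..k. fps_nth (P m) i * fps_nth (f (Suc m)) (k - i))"
      by (simp add: P_Suc fps_mult_nth)
    also have "\<dots> = (\<Sum>i=0..k. if i = k then fps_nth (P m) i else 0)"
      using that by (intro sum.cong) (auto simp: one)
    finally show ?thesis by simp
  qed
  have stable: "fps_nth (P m) k = fps_nth (P k) k" if "k \<le> m" for m k
    using that by (induction m rule: dec_induct) (auto simp: step)
  have Ints: "fps_nth (P m) k \<in> \<int>" for m k
  proof (induction m arbitrary: k)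
    case 0
    then show ?case by (simp add: P_def int)
  next
    case (Suc m)
    then show ?case by (auto simp: P_Suc fps_mult_nth int intro!: Ints_sum Ints_mult)
  qed
  then have "\<exists>z. fps_nth (P k) k = of_int z" for k
    by (metis Ints_cases)
  then obtain c where c: "\<And>k. fps_nth (P k) k = rat_of_int (c k)"
    by metis
  define L where "L = Abs_fps (\<lambda>n. rat_of_int (c n))"
  have "P \<longlonglongrightarrow> L"
  proof (rule tendsto_fpsI)
    fix k
    show "eventually (\<lambda>m. fps_nth (P m) k = fps_nth L k) sequentially"
      by (rule eventually_sequentiallyI [of k]) (metis stable c L_def fps_nth_Abs_fps)
  qed
  moreover have "fps_nth L 0 = 1"
    using c[of 0] by (simp add: L_def P_def one)
  then have "L \<noteq> 0" by auto
  ultimately have "f has_prod L"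
    unfolding has_prod_def raw_has_prod_def by (simp add: P_def [abs_def])
  then show ?thesis unfolding L_def by blast
qed

definition fps_near_one :: "nat \<Rightarrow> rat fps \<Rightarrow> bool" where
  "fps_near_one n f \<longleftrightarrow> (\<forall>k. fps_nth f k \<in> \<int>) \<and> (\<forall>k\<le>n. fps_nth f k = (if k = 0 then 1 else 0))"

lemma fps_near_one_mult:
  assumes f: "fps_near_one n f" and g: "fps_near_one n g"
  shows "fps_near_one n (f * g)"
proof -
  have "fps_nth (f * g) k = (if k = 0 then 1 else 0)" if "k \<le> n" for k
  proof -
    have "fps_nth (f * g) k = (\<Sum>i=0..k. if i = k then fps_nth f i else 0)"
      unfolding fps_mult_nth using that g by (intro sum.cong) (auto simp: fps_near_one_def)
    with that f show ?thesis by (simp add: fps_near_one_def)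
  qed
  moreover have "fps_nth (f * g) k \<in> \<int>" for k
    using f g by (auto simp: fps_near_one_def fps_mult_nth intro!: Ints_sum Ints_mult)
  ultimately show ?thesis by (simp add: fps_near_one_def)
qed

lemma fps_near_one_power: "fps_near_one n f \<Longrightarrow> fps_near_one n (f ^ k)"
  by (induction k) (simp_all add: fps_near_one_mult, simp add: fps_near_one_def)

lemma fps_near_one_1_minus_X_power: "n < m \<Longrightarrow> fps_near_one n (1 - fps_X ^ m)"
  by (auto simp: fps_near_one_def fps_X_power_nth)

lemma fps_near_one_geometric:
  assumes "n < m"
  shows "fps_near_one n (1 / (1 - fps_X ^ m))"
proof -
  define G :: "rat fps" where "G = Abs_fps (\<lambda>k. if m dvd k then 1 else 0)"
  have "(1 - fps_X ^ m) * G = 1"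
  proof (rule fps_ext)
    fix k
    show "fps_nth ((1 - fps_X ^ m) * G) k = fps_nth 1 k"
      using assms
      by (auto simp: G_def left_diff_distrib fps_X_power_mult_nth dvd_imp_le dvd_minus_self)
  qed
  then have "1 / (1 - fps_X ^ m) = G"
    by (metis mult_zero_left nonzero_mult_div_cancel_left zero_neq_one)
  moreover have "fps_near_one n G"
    using assms by (auto simp: G_def fps_near_one_def dest: dvd_imp_le)
  ultimately show ?thesis by simp
qed

lemma eta_power_8_has_prod:
  "\<exists>a :: nat \<Rightarrow> int. (\<lambda>n. (1 - fps_X ^ Suc n) ^ 8) has_prod Abs_fps (\<lambda>n. rat_of_int (a n))"
proof (rule fps_has_prod_Ints)
  have "fps_near_one n ((1 - fps_X ^ Suc n) ^ 8)" for n
    by (intro fps_near_one_power fps_near_one_1_minus_X_power) simp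
  then show "k \<le> n \<Longrightarrow> fps_nth ((1 - fps_X ^ Suc n) ^ 8) k = (if k = 0 then 1 else 0 :: rat)"
    and "fps_nth ((1 - fps_X ^ Suc n) ^ 8) k \<in> (\<int> :: rat set)" for n k
    unfolding fps_near_one_def by blast+
qed

lemma three_core_has_prod:
  "\<exists>b :: nat \<Rightarrow> int. (\<lambda>n. (1 - fps_X ^ (3 * Suc n)) ^ 3 / (1 - fps_X ^ Suc n))
     has_prod Abs_fps (\<lambda>n. rat_of_int (b n))"
proof (rule fps_has_prod_Ints)
  have "fps_near_one n ((1 - fps_X ^ (3 * Suc n)) ^ 3 * (1 / (1 - fps_X ^ Suc n)))" for n
    by (intro fps_near_one_mult fps_near_one_power fps_near_one_1_minus_X_power
        fps_near_one_geometric) simp_all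
  moreover have "(1 - fps_X ^ (3 * Suc n)) ^ 3 * (1 / (1 - fps_X ^ Suc n)) =
      (1 - fps_X ^ (3 * Suc n)) ^ 3 / (1 - fps_X ^ Suc n :: rat fps)" for n
    by (simp add: fps_divide_unit)
  ultimately have "fps_near_one n ((1 - fps_X ^ (3 * Suc n)) ^ 3 / (1 - fps_X ^ Suc n))" for n
    by metis
  then show "k \<le> n \<Longrightarrow>
      fps_nth ((1 - fps_X ^ (3 * Suc n)) ^ 3 / (1 - fps_X ^ Suc n)) k = (if k = 0 then 1 else 0 :: rat)"
    and "fps_nth ((1 - fps_X ^ (3 * Suc n)) ^ 3 / (1 - fps_X ^ Suc n)) k \<in> (\<int> :: rat set)" for n k
    unfolding fps_near_one_def by blast+
qed

end

theory Submission
  imports Defs "HOL-Number_Theory.Number_Theory" "HOL-Library.Discrete_Functions"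
    "HOL-Computational_Algebra.Polynomial"
begin

text \<open>
  Write \<open>\<alpha> = a + b\<omega>\<close> for the elements of \<open>\<int>[\<omega>]\<close>, \<open>\<omega>\<^sup>2 + \<omega> + 1 = 0\<close>, with norm \<open>N(\<alpha>) = a\<^sup>2 - ab + b\<^sup>2\<close>.
  Everything rests on two expansions: \<open>b(n)\<close> counts the \<open>\<alpha> \<equiv> 1 (mod 3)\<close> with \<open>N(\<alpha>) = 3n + 1\<close>, and
  \<open>12 a(n) = \<Sum> \<chi>(\<alpha>)(\<alpha>\<^sup>3 + \<alpha>'\<^sup>3)\<close> over \<open>N(\<alpha>) = 3n + 1\<close>, where \<open>\<alpha>'\<close> is the conjugate of \<open>\<alpha>\<close> and
  \<open>\<chi>\<close> the quadratic character modulo \<open>\<surd>-3\<close>. If a prime \<open>p \<equiv> 2 (mod 3)\<close> divides \<open>3n + 1\<close> to an odd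
  power, no such \<open>\<alpha>\<close> exists and both vanish. Otherwise the sum for \<open>12 a(n)\<close> does not vanish, by the
  Hecke relations: a factor \<open>p\<^sup>2\<close> with \<open>p\<close> inert multiplies it by \<open>- p\<^sup>3\<close>, and a full power of
  a split prime \<open>p = N(\<pi>)\<close> by an integer congruent modulo \<open>p\<close> to a power of the
  integer \<open>\<chi>(\<pi>)(\<pi>\<^sup>3 + \<pi>'\<^sup>3)\<close>, which is prime to \<open>p\<close>. In particular some \<open>\<alpha>\<close> exists, so \<open>b(n) \<noteq> 0\<close>.

  Both expansions come from a finite form of the Jacobi triple product. For \<open>b\<close>, split its factors
  modulo 3 and compare the central coefficients in \<open>z\<close>. For \<open>a\<close>, cube Jacobi's series
  \<open>\<Prod>(1 - x\<^sup>n)\<^sup>3 = \<Sum> (-1)\<^sup>n n x\<^bsup>n(n+1)/2\<^esup>\<close> to obtain \<open>\<Prod>(1 - x\<^sup>n)\<^sup>9\<close> as a sum over \<open>\<int>\<^sup>3\<close>; replace the weight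
  \<open>ijk\<close> by a harmonic cubic that is invariant under the diagonal, sum along the diagonal by Euler's
  pentagonal number theorem, and cancel one factor \<open>\<Prod>(1 - x\<^sup>n)\<close>.
\<close>

section \<open>The Hecke sum over Eisenstein integers\<close>

fun enorm :: "int \<times> int \<Rightarrow> int" where
  "enorm (a, b) = a\<^sup>2 - a * b + b\<^sup>2"

fun emult :: "int \<times> int \<Rightarrow> int \<times> int \<Rightarrow> int \<times> int" where
  "emult (a, b) (c, d) = (a * c - b * d, a * d + b * c - b * d)"

fun econj :: "int \<times> int \<Rightarrow> int \<times> int" where
  "econj (a, b) = (a - b, - b)"

fun escale :: "int \<Rightarrow> int \<times> int \<Rightarrow> int \<times> int" where
  "escale k (a, b) = (k * a, k * b)"

definition chi3 :: "int \<Rightarrow> int" where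
  "chi3 s = (if s mod 3 = 0 then 0 else if s mod 3 = 1 then 1 else - 1)"

text \<open>\<open>trace_cube (a, b) = \<alpha>\<^sup>3 + \<alpha>'\<^sup>3\<close> for \<open>\<alpha> = a + b\<omega>\<close> and its conjugate \<open>\<alpha>'\<close>; also, modulo \<open>\<surd>-3\<close>,
  \<open>\<alpha> \<equiv> a + b\<close>.\<close>
fun trace_cube :: "int \<times> int \<Rightarrow> int" where
  "trace_cube (a, b) = (a + b) * (2 * a - b) * (a - 2 * b)"

text \<open>A unit changes the character and the cube by the same sign, so associates have equal
  values. Without the character the terms for z and -z would cancel.\<close>

definition hecke :: "int \<times> int \<Rightarrow> int" where
  "hecke z = chi3 (fst z + snd z) * trace_cube z"

definition hecke_sum :: "nat \<Rightarrow> int" where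
  "hecke_sum m = (\<Sum>z | enorm z = int m. hecke z)"

lemma enorm_mult: "enorm (emult z w) = enorm z * enorm w"
  by (cases z; cases w) (simp add: algebra_simps power2_eq_square)

lemma enorm_conj [simp]: "enorm (econj z) = enorm z"
  by (cases z) (simp add: algebra_simps power2_eq_square)

lemma enorm_scale: "enorm (escale k z) = k\<^sup>2 * enorm z"
  by (cases z) (simp add: algebra_simps power2_eq_square)

lemma emult_conj: "emult z (emult (econj z) w) = escale (enorm z) w"
  by (cases z; cases w) (simp add: algebra_simps power2_eq_square)

lemma emult_conj': "emult (econj z) (emult z w) = escale (enorm z) w"
  by (cases z; cases w) (simp add: algebra_simps power2_eq_square)

lemma four_enorm: "4 * enorm (a, b) = (2 * a - b)\<^sup>2 + 3 * b\<^sup>2"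
  "4 * enorm (a, b) = (2 * b - a)\<^sup>2 + 3 * a\<^sup>2"
  by (simp_all add: algebra_simps power2_eq_square)

lemma finite_enorm_le: "finite {z. enorm z \<le> n}"
proof (rule finite_subset)
  show "{z. enorm z \<le> n} \<subseteq> {- 2 * n..2 * n} \<times> {- 2 * n..2 * n}"
  proof (rule subsetI, clarify)
    fix a b :: int assume n: "enorm (a, b) \<le> n"
    have *: "\<bar>x\<bar> \<le> 2 * n" if "3 * x\<^sup>2 \<le> 4 * n" for x
    proof -
      have "\<bar>x\<bar> * 1 \<le> \<bar>x\<bar> * \<bar>x\<bar>" if "x \<noteq> 0"
        using that by (intro mult_left_mono) auto
      then have "\<bar>x\<bar> \<le> x\<^sup>2" by (cases "x = 0") (auto simp: power2_eq_square)
      then show ?thesis using that by linarith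
    qed
    have "3 * b\<^sup>2 \<le> 4 * n" "3 * a\<^sup>2 \<le> 4 * n"
      using n four_enorm[of a b] zero_le_power2[of "2 * a - b"] zero_le_power2[of "2 * b - a"]
      by linarith+
    then show "a \<in> {- 2 * n..2 * n} \<and> b \<in> {- 2 * n..2 * n}"
      using *[of a] *[of b] by auto
  qed
qed auto

lemma finite_enorm_eq [simp]: "finite {z. enorm z = n}"
  by (rule finite_subset[OF _ finite_enorm_le[of n]]) auto

lemma chi3_cong: "s mod 3 = t mod 3 \<Longrightarrow> chi3 s = chi3 t"
  by (simp add: chi3_def)

lemma chi3_mult: "chi3 (s * t) = chi3 s * chi3 t"
proof -
  have *: "u = 0 \<or> u = 1 \<or> u = 2" if "u = s mod 3" for u s :: int
    using that pos_mod_bound[of 3 s] pos_mod_sign[of 3 s] by linarith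
  obtain u v where uv: "u = s mod 3" "v = t mod 3" by blast
  have "chi3 (s * t) = chi3 (u * v)" "chi3 s = chi3 u" "chi3 t = chi3 v"
    by (rule chi3_cong; simp add: uv mod_mult_eq)+
  moreover have "chi3 (u * v) = chi3 u * chi3 v"
    using *[OF uv(1)] *[OF uv(2)] by (elim disjE) (simp_all add: chi3_def)
  ultimately show ?thesis by simp
qed

lemma hecke_scale: "hecke (escale k z) = chi3 k * k ^ 3 * hecke z"
proof (cases z)
  case (Pair a b)
  have "chi3 (k * a + k * b) = chi3 k * chi3 (a + b)"
    by (simp add: chi3_mult flip: distrib_left)
  then show ?thesis
    by (simp add: Pair hecke_def power3_eq_cube algebra_simps)
qed

text \<open>Conjugation is trivial modulo \<open>\<surd>-3\<close>, so both products have the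
  same character, and what remains is multiplicativity of \<open>\<alpha>\<^sup>3\<close>.\<close>
lemma hecke_mult_add_conj:
  "hecke (emult z w) + hecke (emult (econj z) w) = hecke z * hecke w"
proof (cases z; cases w)
  fix a b c d assume [simp]: "z = (a, b)" "w = (c, d)"
  have "a * c - b * d + (a * d + b * c - b * d) = (a + b) * (c + d) + 3 * (- b * d)"
    by (simp add: algebra_simps)
  then have "(a * c - b * d + (a * d + b * c - b * d)) mod 3 = ((a + b) * (c + d)) mod 3"
    by (metis mod_mult_self2)
  then have 1: "chi3 (a * c - b * d + (a * d + b * c - b * d)) = chi3 (a + b) * chi3 (c + d)"
    using chi3_cong chi3_mult by metis
  have "(a - b) * c - (- b) * d + ((a - b) * d + (- b) * c - (- b) * d) 
      = (a + b) * (c + d) + 3 * (- b * c)"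
    by (simp add: algebra_simps)
  then have "((a - b) * c - (- b) * d + ((a - b) * d + (- b) * c - (- b) * d)) mod 3 
      = ((a + b) * (c + d)) mod 3"
    by (metis mod_mult_self2)
  then have 2: "chi3 ((a - b) * c - (- b) * d + ((a - b) * d + (- b) * c - (- b) * d))
      = chi3 (a + b) * chi3 (c + d)"
    using chi3_cong chi3_mult by metis
  have 3: "trace_cube (emult z w) + trace_cube (emult (econj z) w) = trace_cube z * trace_cube w"
    unfolding \<open>z = (a, b)\<close> \<open>w = (c, d)\<close> emult.simps econj.simps trace_cube.simps
    by (simp add: algebra_simps power2_eq_square)
  have "hecke (emult z w) = chi3 (a + b) * chi3 (c + d) * trace_cube (emult z w)"
    using 1 by (simp add: hecke_def del: trace_cube.simps)
  moreover have "hecke (emult (econj z) w) = chi3 (a + b) * chi3 (c + d) * trace_cube (emult (econj z) w)"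
    using 2 by (simp add: hecke_def del: trace_cube.simps)
  moreover have "hecke z * hecke w = chi3 (a + b) * chi3 (c + d) * (trace_cube z * trace_cube w)"
    by (simp add: hecke_def del: trace_cube.simps)
  ultimately show ?thesis
    by (simp only: 3[symmetric] distrib_left)
qed

lemma inj_emult: "enorm z \<noteq> 0 \<Longrightarrow> inj (emult z)"
proof (rule injI)
  fix v w assume "enorm z \<noteq> 0" "emult z v = emult z w"
  then have "escale (enorm z) v = escale (enorm z) w"
    by (metis emult_conj')
  then show "v = w" using \<open>enorm z \<noteq> 0\<close> by (cases v; cases w) simp
qed

lemma inj_escale: "k \<noteq> 0 \<Longrightarrow> inj (escale k)"
  by (rule injI) (auto elim: escale.elims)

text \<open>If p divides v, the norm is u^2 modulo p.\<close>

lemma prime_dvd_scale_of_snd: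
  fixes p :: int
  assumes "prime p" "p dvd enorm (u, v)" "p dvd v"
  shows "p dvd u"
proof -
  have "p dvd v * (u - v)" using assms by simp
  then have "p dvd (u\<^sup>2 - u * v + v\<^sup>2) + v * (u - v)"
    using assms(2) dvd_add unfolding enorm.simps by blast
  also have "(u\<^sup>2 - u * v + v\<^sup>2) + v * (u - v) = u\<^sup>2" by (simp add: algebra_simps power2_eq_square)
  finally show ?thesis using assms prime_dvd_power by blast
qed

section \<open>Split primes and the Hecke relation\<close>

context
  fixes p :: nat and c d :: int
  assumes p: "prime p" "p \<noteq> 3" and odd_p: "odd p" and norm: "enorm (c, d) = int p"
begin

lemma prime_p: "prime (int p)" using p by simp

text \<open>If p divides d, it divides c as well, and p^2 would divide the norm p. If p divides 2c -
  d, completing the square shows that p divides 3d^2, against p \<noteq> 3.\<close>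

lemma split_prime_not_dvd: "\<not> int p dvd d" "\<not> int p dvd 2 * c - d"
proof -
  have sq: "\<not> int p * int p dvd int p"
    using p prime_gt_1_nat[of p] by (auto dest!: zdvd_imp_le)
  show d: "\<not> int p dvd d"
  proof
    assume d: "int p dvd d"
    then have c: "int p dvd c" 
      using prime_dvd_scale_of_snd[OF prime_p, of c d] norm by simp
    then have "int p * int p dvd c * c" "int p * int p dvd c * d" "int p * int p dvd d * d"
      using d by (auto intro: mult_dvd_mono)
    then have "int p * int p dvd c * c - c * d + d * d" by (intro dvd_add dvd_diff)
    then show False using sq norm by (simp add: power2_eq_square)
  qed
  show "\<not> int p dvd 2 * c - d"
  proof
    assume "int p dvd 2 * c - d"
    then have "int p dvd 4 * enorm (c, d) - (2 * c - d) * (2 * c - d)" using norm by simp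
    also have "\<dots> = 3 * (d * d)" by (simp add: power2_eq_square algebra_simps)
    finally have "int p dvd 3" using d prime_p by (simp add: prime_dvd_mult_iff)
    then have "p dvd 3" by (metis of_nat_dvd_iff of_nat_numeral)
    then show False using p primes_dvd_imp_eq[of p 3] by simp
  qed
qed

text \<open>Put \<pi> = \<open>(c, d)\<close> with conjugate \<pi>'. Since \<pi>\<pi>' = p, \<pi>
  divides z exactly when p divides \<pi>'z. The norm of \<pi>'z is a multiple of p, so its second
  coordinate decides this.\<close>

lemma split_prime_dvd_iff_snd:
  assumes "int p dvd enorm z"
  shows "z \<in> range (emult (c, d)) \<longleftrightarrow> int p dvd snd (emult (econj (c, d)) z)"
proof
  assume "z \<in> range (emult (c, d))"
  then obtain w where "z = emult (c, d) w" by auto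
  then have "emult (econj (c, d)) z = escale (int p) w"
    using emult_conj' norm by metis
  then show "int p dvd snd (emult (econj (c, d)) z)" by (cases w) simp
next
  assume v: "int p dvd snd (emult (econj (c, d)) z)"
  have "int p dvd enorm (emult (econj (c, d)) z)"
    unfolding enorm_mult using assms by simp
  then have "int p dvd fst (emult (econj (c, d)) z)"
    using prime_dvd_scale_of_snd[OF prime_p] v by (metis prod.collapse)
  with v obtain x y where xy: "emult (econj (c, d)) z = escale (int p) (x, y)"
    by (metis dvdE escale.simps prod.collapse)
  have "escale (int p) (emult (c, d) (x, y)) = emult (c, d) (escale (int p) (x, y))"
    by (simp add: algebra_simps)
  also have "\<dots> = escale (int p) z"
    unfolding xy[symmetric] emult_conj norm ..
  finally have "z = emult (c, d) (x, y)"
    using inj_escale[of "int p"] p by (metis injD of_nat_eq_0_iff not_prime_0)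
  then show "z \<in> range (emult (c, d))" by blast
qed

text \<open>The sum and the difference of the two coordinates are b(2c - d) and d(2a - b) for z =
  (a, b). Hence p divides b and 2a - b, and then a because p is odd.\<close>

lemma split_prime_dvd_both:
  assumes "int p dvd snd (emult (econj (c, d)) z)" "int p dvd snd (emult (c, d) z)"
  shows "z \<in> range (escale p)"
proof (cases z)
  case (Pair a b)
  from assms have 1: "int p dvd (c - d) * b - d * a + d * b" and 2: "int p dvd c * b + d * a - d * b"
    by (simp_all add: Pair algebra_simps)
  from dvd_diff[OF 2 1] have "int p dvd d * (2 * a - b)" by (simp add: algebra_simps)
  then have 3: "int p dvd 2 * a - b"
    using split_prime_not_dvd prime_p by (simp add: prime_dvd_mult_iff)
  from dvd_add[OF 2 1] have "int p dvd b * (2 * c - d)" by (simp add: algebra_simps)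
  then have b: "int p dvd b"
    using split_prime_not_dvd prime_p by (simp add: prime_dvd_mult_iff)
  from dvd_add[OF 3 b] have "int p dvd 2 * a" by simp
  moreover have "\<not> int p dvd 2"
    using primes_dvd_imp_eq[of p 2] p odd_p by (metis of_nat_dvd_iff of_nat_numeral two_is_prime_nat even_numeral)
  ultimately have "int p dvd a" using prime_p prime_dvd_mult_iff by blast
  with b obtain x y where "z = escale p (x, y)" by (metis Pair dvdE escale.simps)
  then show ?thesis by blast
qed

end

text \<open>A multiple z = pw has norm pm iff p N(w) = m. For a split prime these are the elements
  counted twice in the Hecke relation; for an inert prime there are no other elements of norm
  pm.\<close>

lemma hecke_sum_over_multiples:
  assumes "p > 0"
  shows "(\<Sum>z\<in>escale p ` {z. int p * enorm z = int m}. hecke z) =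
    (if p dvd m then chi3 p * int p ^ 3 * hecke_sum (m div p) else 0)"
proof (cases "p dvd m")
  case True
  have "int p * n = int m \<longleftrightarrow> n = int (m div p)" for n
    using True assms by (auto simp: zdiv_int)
  moreover have "inj_on (escale p) A" for A
    using inj_escale[of "int p"] assms inj_on_subset by auto
  ultimately show ?thesis
    using True by (simp add: sum.reindex hecke_sum_def sum_distrib_left hecke_scale)
next
  case False
  then have "int p * n \<noteq> int m" for n
    by (metis dvd_triv_left int_dvd_int_iff)
  then show ?thesis using False by simp
qed

text \<open>Every element of norm pm is a multiple of \<pi> or of \<pi>'. By inclusion and
  exclusion, the two sums combine through \<open>hecke_mult_add_conj\<close>, and the common
  multiples are the multiples of p.\<close>

lemma hecke_sum_split_prime:
  assumes "prime p" "p \<noteq> 3" "odd p" and norm: "enorm (c, d) = int p"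
  shows "hecke_sum (p * m) = hecke (c, d) * hecke_sum m -
    (if p dvd m then chi3 p * int p ^ 3 * hecke_sum (m div p) else 0)"
proof -
  define S where "S k = {z. enorm z = int k}" for k
  define A where "A = emult (c, d) ` S m"
  define B where "B = emult (econj (c, d)) ` S m"
  have p: "p > 0" using assms prime_gt_0_nat by auto
  have norm': "enorm (c - d, - d) = int p" using norm enorm_conj[of "(c, d)"] by simp
  have image: "emult w ` S m = S (p * m) \<inter> range (emult w)" if "enorm w = int p" for w
    using that p by (auto simp: S_def enorm_mult simp del: enorm.simps)
  have A: "z \<in> A \<longleftrightarrow> z \<in> S (p * m) \<and> z \<in> range (emult (c, d))" for z
    unfolding A_def image[OF norm] by blast
  have B: "z \<in> B \<longleftrightarrow> z \<in> S (p * m) \<and> z \<in> range (emult (econj (c, d)))" for z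
    unfolding B_def econj.simps image[OF norm'] by blast
  have dvd: "z \<in> range (emult (c, d)) \<longleftrightarrow> int p dvd snd (emult (econj (c, d)) z)"
    "z \<in> range (emult (econj (c, d))) \<longleftrightarrow> int p dvd snd (emult (c, d) z)" if "z \<in> S (p * m)" for z
    using split_prime_dvd_iff_snd[OF assms(1-3) norm, of z]
      split_prime_dvd_iff_snd[OF assms(1-3) norm', of z] that by (auto simp: S_def)
  have "S (p * m) \<subseteq> A \<union> B"
  proof
    fix z assume z: "z \<in> S (p * m)"
    obtain a b where ab: "z = (a, b)" by fastforce
    \<comment> \<open>Both norms on the right are divisible by p, so p divides one of the two
      coordinates that test divisibility by \<pi> and \<pi>'.\<close>
    have "snd (emult (econj (c, d)) z) * snd (emult (c, d) z) = b\<^sup>2 * enorm (c, d) - d\<^sup>2 * enorm z"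
      by (simp add: ab algebra_simps power2_eq_square)
    also have "int p dvd \<dots>"
      using z norm by (simp add: S_def del: enorm.simps)
    finally have "int p dvd snd (emult (econj (c, d)) z) \<or> int p dvd snd (emult (c, d) z)"
      using assms(1) prime_dvd_mult_iff[of "int p"] by simp
    then show "z \<in> A \<union> B" using A B dvd z by auto
  qed
  then have union: "S (p * m) = A \<union> B" using A B by auto
  have "z \<in> escale p ` {z. int p * enorm z = int m}" if "z \<in> A \<inter> B" for z
  proof -
    have z: "z \<in> S (p * m)" using that A by auto
    have "z \<in> range (emult (c, d))" "z \<in> range (emult (econj (c, d)))"
      using that A B by auto
    then have "z \<in> range (escale p)"
      using split_prime_dvd_both[OF assms(1-3) norm, of z] dvd[OF z] by simp
    then obtain w where w: "z = escale p w" by blast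
    with z p have "int p * enorm w = int m"
      by (simp add: S_def enorm_scale power2_eq_square)
    then show ?thesis using w by auto
  qed
  moreover have "z \<in> A \<inter> B" if z: "z \<in> escale p ` {z. int p * enorm z = int m}" for z
  proof -
    obtain w where w: "z = escale p w" "int p * enorm w = int m" using z by blast
    then have "z \<in> S (p * m)" by (simp add: S_def enorm_scale power2_eq_square)
    moreover have "z = emult (c, d) (emult (econj (c, d)) w)" "z = emult (econj (c, d)) (emult (c, d) w)"
      using w norm by (simp_all only: emult_conj emult_conj')
    ultimately show ?thesis using A B by blast
  qed
  ultimately have inter: "A \<inter> B = escale p ` {z. int p * enorm z = int m}" by blast
  have inj: "inj_on (emult (c, d)) (S m)" "inj_on (emult (econj (c, d))) (S m)"
    using inj_emult[of "(c, d)"] inj_emult[of "econj (c, d)"] norm p inj_on_subset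
    by (auto simp del: enorm.simps econj.simps)
  have "hecke_sum (p * m) + sum hecke (A \<inter> B) = sum hecke A + sum hecke B"
    using sum.union_inter[of A B hecke] union by (simp add: hecke_sum_def S_def A_def B_def)
  also have "\<dots> = (\<Sum>w\<in>S m. hecke (emult (c, d) w) + hecke (emult (econj (c, d)) w))"
    unfolding A_def B_def using inj by (simp add: sum.reindex sum.distrib)
  also have "\<dots> = hecke (c, d) * hecke_sum m"
    unfolding hecke_mult_add_conj by (simp add: hecke_sum_def S_def sum_distrib_left)
  finally show ?thesis
    using hecke_sum_over_multiples[OF p, of m] inter by simp
qed

section \<open>Inert primes\<close>

lemma fermat_int:
  fixes a :: int
  assumes "prime p" "\<not> int p dvd a"
  shows "[a ^ (p - 1) = 1] (mod int p)"
proof -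
  have p: "int p > 0" using assms(1) prime_gt_0_nat by auto
  define n where "n = nat (a mod int p)"
  have n: "int n = a mod int p" using p by (simp add: n_def)
  then have "\<not> p dvd n"
    using assms(2) by (metis dvd_mod_iff dvd_refl int_dvd_int_iff)
  then have "[int (n ^ (p - 1)) = int 1] (mod int p)"
    using fermat_theorem[OF assms(1)] cong_int_iff by blast
  moreover have "[a ^ (p - 1) = int n ^ (p - 1)] (mod int p)"
    unfolding n by (intro cong_pow) (simp add: cong_def)
  ultimately show ?thesis using cong_trans by auto
qed

text \<open>Cubing is injective modulo p = 3k + 2: the norm divides a^3 + b^3, so a^3 = -b^3 modulo
  p, and the k-th power together with Fermat's theorem gives b = \<plusminus>a. The norm is then ab
  or -3ab modulo p, which is not 0 unless p divides a or b.\<close>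

lemma inert_prime_dvd_enorm:
  assumes "prime p" "p mod 3 = 2" "int p dvd enorm z"
  shows "z \<in> range (escale p)"
proof (cases z)
  case (Pair a b)
  have p: "prime (int p)" using assms by simp
  have norm: "int p dvd enorm (a, b)" "int p dvd enorm (b, a)"
    using assms(3) by (simp_all add: Pair algebra_simps)
  have "int p dvd b"
  proof (rule ccontr)
    assume b: "\<not> int p dvd b"
    then have a: "\<not> int p dvd a"
      using prime_dvd_scale_of_snd[OF p norm(2)] by blast
    obtain k where k: "p - 1 = Suc (3 * k)"
      using assms(2) by (intro that[of "p div 3"]) presburger
    define s :: int where "s = (- 1) ^ k"
    have s: "s * s = 1" by (simp add: s_def flip: power_add mult_2)
    have "a ^ 3 - - (b ^ 3) = (a + b) * enorm (a, b)"
      by (simp add: algebra_simps power2_eq_square power3_eq_cube)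
    then have "int p dvd a ^ 3 - - (b ^ 3)"
      using norm by (metis dvd_mult)
    then have "[a ^ 3 = - (b ^ 3)] (mod int p)" by (simp add: cong_iff_dvd_diff)
    then have "[(a ^ 3) ^ k = (- (b ^ 3)) ^ k] (mod int p)" by (rule cong_pow)
    also have "(- (b ^ 3)) ^ k = s * b ^ (3 * k)"
      unfolding s_def by (simp add: power_minus[of "b ^ 3"] power_mult)
    finally have "[(a ^ 3) ^ k * (a * b) = s * b ^ (3 * k) * (a * b)] (mod int p)"
      by (rule cong_scalar_right)
    then have "[a ^ (p - 1) * b = s * a * b ^ (p - 1)] (mod int p)"
      unfolding k by (simp add: mult_ac flip: power_mult)
    moreover have "[a ^ (p - 1) * b = 1 * b] (mod int p)" "[s * a * b ^ (p - 1) = s * a * 1] (mod int p)"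
      using fermat_int[OF assms(1) a] fermat_int[OF assms(1) b]
      by (blast intro: cong_scalar_right, blast intro: cong_scalar_left)
    ultimately have "[b = s * a] (mod int p)"
      by (metis cong_sym cong_trans mult_1 mult_1_right)
    then have "[b * b = (s * a) * (s * a)] (mod int p)" by (intro cong_mult)
    also have "(s * a) * (s * a) = (s * s) * (a * a)" by (simp only: mult_ac)
    finally have "int p dvd b * b - a * a" by (simp add: s cong_iff_dvd_diff)
    then have "int p dvd (b - a) * (b + a)" by (simp add: algebra_simps)
    then consider "int p dvd b - a" | "int p dvd b + a"
      using p prime_dvd_mult_iff by blast
    then show False
    proof cases
      case 1
      then have "int p dvd enorm (a, b) - (b - a) * (b - a)" using norm by (intro dvd_diff) auto
      then have "int p dvd a * b" by (simp add: algebra_simps power2_eq_square)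
      then show False using a b p prime_dvd_mult_iff by blast
    next
      case 2
      then have "int p dvd (b + a) * (b + a) - enorm (a, b)" using norm by (intro dvd_diff) auto
      then have "int p dvd 3 * (a * b)" by (simp add: algebra_simps power2_eq_square)
      then have "int p dvd 3" using a b p prime_dvd_mult_iff by blast
      then have "p dvd 3" by (metis of_nat_dvd_iff of_nat_numeral)
      then show False using assms primes_dvd_imp_eq[of p 3] by simp
    qed
  qed
  moreover from this have "int p dvd a" using prime_dvd_scale_of_snd[OF p norm(1)] by blast
  ultimately obtain x y where "z = escale p (x, y)" by (metis Pair dvdE escale.simps)
  then show ?thesis by blast
qed

text \<open>Descent: whenever p divides the norm, z itself is a multiple of p, and passing to z/p
  removes exactly the factor p^2 from the norm.\<close>

lemma even_multiplicity_enorm: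
  assumes "prime p" "p mod 3 = 2" "enorm z = int m" "m > 0"
  shows "even (multiplicity p m)"
  using assms(3,4)
proof (induction m arbitrary: z rule: less_induct)
  case (less m)
  show ?case
  proof (cases "p dvd m")
    case True
    then have "int p dvd enorm z" using less.prems by simp
    then obtain w where w: "z = escale p w" using inert_prime_dvd_enorm assms by blast
    have m: "int m = int p * (int p * enorm w)"
      using less.prems(1) by (simp add: w enorm_scale power2_eq_square)
    with \<open>m > 0\<close> have "enorm w > 0"
      by (metis of_nat_0_less_iff of_nat_less_0_iff zero_less_mult_iff)
    then obtain k where k: "enorm w = int k" "k > 0" using zero_less_imp_eq_int by blast
    then have mk: "m = p * (p * k)" using m by (metis of_nat_eq_iff of_nat_mult)
    moreover have "1 < p * p" using prime_gt_1_nat[OF assms(1)] by (simp add: one_less_mult)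
    ultimately have "k < p * (p * k)" using k by simp
    then have "even (multiplicity p k)" using less.IH[of k w] k mk by simp
    then show ?thesis
      unfolding mk using assms(1) k by (simp add: prime_elem_multiplicity_mult_distrib)
  next
    case False
    then show ?thesis by (simp add: not_dvd_imp_multiplicity_0)
  qed
qed

text \<open>All elements of norm p^2 m are multiples of p, and \<open>chi3 p = - 1\<close>.\<close>

lemma hecke_sum_inert_prime:
  assumes "prime p" "p mod 3 = 2"
  shows "hecke_sum (p * (p * m)) = - (int p ^ 3) * hecke_sum m"
proof -
  have p: "p > 0" using assms prime_gt_0_nat by auto
  have "{z. enorm z = int (p * (p * m))} = escale p ` {z. int p * enorm z = int (p * m)}"
  proof (intro subset_antisym subsetI)
    fix z assume z: "z \<in> {z. enorm z = int (p * (p * m))}"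
    then have "int p dvd enorm z" by simp
    then obtain w where w: "z = escale p w" using inert_prime_dvd_enorm assms by blast
    then have "int p * enorm w = int (p * m)"
      using z p by (simp add: enorm_scale power2_eq_square)
    with w show "z \<in> escale p ` {z. int p * enorm z = int (p * m)}" by blast
  next
    fix z assume "z \<in> escale p ` {z. int p * enorm z = int (p * m)}"
    then obtain w where "z = escale p w" "int p * enorm w = int (p * m)" by blast
    then show "z \<in> {z. enorm z = int (p * (p * m))}"
      by (simp add: enorm_scale power2_eq_square)
  qed
  then have "hecke_sum (p * (p * m)) = chi3 p * int p ^ 3 * hecke_sum m"
    using hecke_sum_over_multiples[OF p, of "p * m"] p by (simp add: hecke_sum_def)
  moreover have "int p mod 3 = 2" using assms(2) by (metis of_nat_mod of_nat_numeral)
  ultimately show ?thesis by (simp add: chi3_def)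
qed

section \<open>Nonvanishing of the Hecke sum\<close>

text \<open>The six units contribute 2 each.\<close>

lemma hecke_sum_1: "hecke_sum 1 = 12"
proof -
  have "{z. enorm z = int 1} = {(1, 0), (0, 1), (1, 1), (-1, 0), (0, -1), (-1, -1)}"
  proof (intro subset_antisym subsetI)
    fix z assume z: "z \<in> {z. enorm z = int 1}"
    obtain a b where ab: "z = (a, b)" by fastforce
    have *: "x \<in> {-1, 0, 1}" if "3 * x\<^sup>2 \<le> 4" for x :: int
    proof -
      have "x\<^sup>2 \<le> 1" using that by linarith
      then have "\<bar>x\<bar> \<le> 1" by (simp add: abs_square_le_1)
      then show ?thesis by auto
    qed
    have "3 * b\<^sup>2 \<le> 4" "3 * a\<^sup>2 \<le> 4"
      using z ab four_enorm[of a b] zero_le_power2[of "2 * a - b"] zero_le_power2[of "2 * b - a"]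
      unfolding mem_Collect_eq by (simp_all del: enorm.simps, linarith+)
    then have "a \<in> {-1, 0, 1}" "b \<in> {-1, 0, 1}" using * by blast+
    then show "z \<in> {(1, 0), (0, 1), (1, 1), (-1, 0), (0, -1), (-1, -1)}"
      using z ab by auto
  qed auto
  then show ?thesis by (simp add: hecke_sum_def hecke_def chi3_def)
qed

text \<open>A power of a primitive root is an element x of order 3 modulo p. The pigeonhole
  principle gives u + xv = 0 modulo p with u^2, v^2 and |uv| below p, so the norm of (u, v) is p or
  2p. It is not 2p, because an even norm is divisible by 4.\<close>

lemma ex_enorm_eq_prime:
  assumes "prime p" "p mod 3 = 1"
  obtains c d where "enorm (c, d) = int p"
proof -
  have p: "prime (int p)" using assms by simp
  have p2: "p > 2" using assms prime_ge_2_nat[of p] by (cases "p = 2") auto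
  then have odd_p: "odd p" using assms(1) prime_odd_nat by blast
  obtain k where k: "p - 1 = 3 * k" "k > 0"
    using assms(2) p2 by (intro that[of "p div 3"]) presburger+
  obtain g where "residue_primroot p g" using prime_primitive_root_exists[of p] assms(1) p2 by auto
  then have ord: "ord p g = 3 * k" "coprime p g"
    using assms(1) k by (auto simp: residue_primroot_def totient_prime)
  define x :: int where "x = int (g ^ k)"
  have "\<not> [g ^ k = 1] (mod p)" "[g ^ (3 * k) = 1] (mod p)"
    using ord k unfolding ord_divides by (auto dest: dvd_imp_le)
  then have "\<not> [x = 1] (mod int p)" "[x ^ 3 = 1] (mod int p)"
    using cong_int_iff[of "g ^ k" 1 p] cong_int_iff[of "g ^ (3 * k)" 1 p]
    by (auto simp: x_def power_mult mult.commute)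
  then have "\<not> int p dvd x - 1" "int p dvd (x - 1) * (x * x + x + 1)"
    by (simp_all add: cong_iff_dvd_diff algebra_simps power3_eq_cube)
  then have x: "int p dvd x * x + x + 1"
    using p prime_dvd_mult_iff by blast
  define s where "s = floor_sqrt p"
  have s1: "s\<^sup>2 \<le> p" and s2: "p < (Suc s)\<^sup>2" unfolding s_def by (auto simp: Suc_floor_sqrt_power2_gt)
  have "s\<^sup>2 \<noteq> p"
    using assms(1) prime_product[of s s] not_prime_1 by (auto simp: power2_eq_square)
  with s1 have s1: "int s * int s < int p" by (metis le_neq_implies_less of_nat_less_iff of_nat_mult power2_eq_square)
  \<comment> \<open>Thue's lemma\<close>
  define f where "f = (\<lambda>(i, j). (int i + x * int j) mod int p)"
  have "f ` ({..s} \<times> {..s}) \<subseteq> {0..<int p}" using p2 by (auto simp: f_def)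
  then have "card (f ` ({..s} \<times> {..s})) \<le> p" using card_mono[of "{0..<int p}"] by fastforce
  also have "p < card ({..s} \<times> {..s})" using s2 by (simp add: power2_eq_square)
  finally have "\<not> inj_on f ({..s} \<times> {..s})" by (rule pigeonhole)
  then obtain i j i' j' where ij: "i \<le> s" "j \<le> s" "i' \<le> s" "j' \<le> s" "(i, j) \<noteq> (i', j')" 
    "f (i, j) = f (i', j')"
    unfolding inj_on_def by auto
  define u v where "u = int i - int i'" and "v = int j - int j'"
  have "int p dvd u + x * v"
    using ij(6) by (simp add: f_def u_def v_def mod_eq_dvd_iff algebra_simps)
  \<comment> \<open>With x in the role of \<omega> and -1 - x in that of its conjugate, the norm
    factors modulo p as (u + xv)(u + (-1 - x)v).\<close>
  then have "int p dvd (u + x * v) * (u - v - x * v) + (x * x + x + 1) * (v * v)"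
    using x by (rule dvd_add[OF dvd_mult2 dvd_mult2])
  also have "\<dots> = enorm (u, v)" by (simp add: algebra_simps power2_eq_square)
  finally obtain n where n: "enorm (u, v) = int p * n" by blast
  have uv: "\<bar>u\<bar> \<le> int s" "\<bar>v\<bar> \<le> int s" using ij by (auto simp: u_def v_def)
  have "\<bar>y\<bar> * \<bar>z\<bar> \<le> int s * int s" if "\<bar>y\<bar> \<le> int s" "\<bar>z\<bar> \<le> int s" for y z :: int
    by (rule mult_mono[OF that]) simp_all
  from this[OF uv(1) uv(1)] this[OF uv(2) uv(2)] this[OF uv]
  have "\<bar>u\<bar> * \<bar>u\<bar> \<le> int s * int s" "\<bar>v\<bar> * \<bar>v\<bar> \<le> int s * int s" "\<bar>u\<bar> * \<bar>v\<bar> \<le> int s * int s" .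
  moreover have "- (u * v) \<le> \<bar>u\<bar> * \<bar>v\<bar>" by (metis abs_ge_minus_self abs_mult)
  ultimately have "enorm (u, v) < 3 * int p"
    using s1 by (simp add: power2_eq_square)
  then have n3: "n < 3" using n p2 by (simp add: mult.commute)
  have "enorm (u, v) > 0"
  proof -
    have "u \<noteq> 0 \<or> v \<noteq> 0" using ij by (auto simp: u_def v_def)
    then have "0 < 3 * v\<^sup>2 \<or> 0 < 3 * u\<^sup>2" by auto
    then show ?thesis using four_enorm[of u v] zero_le_power2[of "2 * u - v"] zero_le_power2[of "2 * v - u"] by linarith
  qed
  then have "n > 0" using n p2 by (simp add: zero_less_mult_iff)
  moreover have "n \<noteq> 2"
  proof
    assume "n = 2"
    then have e: "even (enorm (u, v))" using n by simp
    then have "even u" "even v" by auto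
    then obtain u' v' where "u = 2 * u'" "v = 2 * v'" by blast
    then have "int p * 2 = 4 * enorm (u', v')" using n \<open>n = 2\<close> by (simp add: power2_eq_square algebra_simps)
    then have "int p = 2 * enorm (u', v')" by simp
    then have "even (int p)" by (metis dvd_triv_left)
    then show False using odd_p by simp
  qed
  ultimately have "n = 1" using n3 by simp
  then show thesis using n that by simp
qed

text \<open>Up to sign, the three factors of the cube trace are the value 2c - d taken at (c, d),
  (d, c) and (c, c - d), which all have norm p, so \<open>split_prime_not_dvd\<close> applies to
  each. The character is \<plusminus>1 because 3 does not divide p.\<close>

lemma split_prime_not_dvd_hecke:
  assumes "prime p" "p \<noteq> 3" "odd p" and norm: "enorm (c, d) = int p"
  shows "\<not> int p dvd hecke (c, d)"
proof -
  have p: "prime (int p)" using assms by simp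
  have "\<not> 3 dvd c + d"
  proof
    assume "3 dvd c + d"
    then have "3 dvd (c + d) * (c + d) - 3 * (c * d)" by (intro dvd_diff) auto
    also have "(c + d) * (c + d) - 3 * (c * d) = int p"
      using norm by (simp add: power2_eq_square algebra_simps)
    finally have "3 dvd p" by presburger
    then show False using assms primes_dvd_imp_eq[of 3 p] by simp
  qed
  then have chi: "chi3 (c + d) = 1 \<or> chi3 (c + d) = - 1"
    by (auto simp: chi3_def dvd_eq_mod_eq_0)
  have "enorm (d, c) = int p" "enorm (c, c - d) = int p"
    using norm by (simp_all add: power2_eq_square algebra_simps)
  then have "\<not> int p dvd 2 * c - d" "\<not> int p dvd 2 * d - c" "\<not> int p dvd 2 * c - (c - d)"
    using split_prime_not_dvd(2)[OF assms(1-3)] norm by blast+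
  moreover have "c - 2 * d = - (2 * d - c)" "2 * c - (c - d) = c + d" by simp_all
  ultimately have "\<not> int p dvd trace_cube (c, d)"
    using p by (metis dvd_minus_iff prime_dvd_mult_iff trace_cube.simps)
  with chi show ?thesis by (auto simp: hecke_def simp del: trace_cube.simps)
qed

text \<open>By the Hecke relation the multipliers satisfy u(e+2) = h u(e+1) - \<chi>(p) p^3 u(e)
  with u(0) = 1 and u(1) = h, so u(e) = h^e modulo p. The recurrence has order two, hence the
  induction carries two consecutive exponents.\<close>

lemma hecke_sum_split_prime_power:
  assumes "prime p" "p mod 3 = 1" "\<not> p dvd m"
  obtains u where "\<not> int p dvd u" "hecke_sum (p ^ e * m) = u * hecke_sum m"
proof -
  have p: "prime (int p)" and p3: "p \<noteq> 3" and odd_p: "odd p"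
    using assms prime_odd_nat[of p] prime_ge_2_nat[of p] by (cases "p = 2"; auto)+
  obtain c d where norm: "enorm (c, d) = int p" using ex_enorm_eq_prime assms by blast
  note split = hecke_sum_split_prime[OF assms(1) p3 odd_p norm]
  note ndvd = split_prime_not_dvd_hecke[OF assms(1) p3 odd_p norm]
  define h where "h = hecke (c, d)"
  have "\<exists>u v. \<not> int p dvd u \<and> \<not> int p dvd v \<and> hecke_sum (p ^ e * m) = u * hecke_sum m \<and>
      hecke_sum (p ^ Suc e * m) = v * hecke_sum m"
  proof (induction e)
    case 0
    show ?case
    proof (intro exI conjI)
      show "\<not> int p dvd 1" using p by (meson not_prime_unit)
      show "\<not> int p dvd h" using ndvd h_def by simp
    qed (use split[of m] assms in \<open>simp_all add: h_def\<close>)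
  next
    case (Suc e)
    then obtain u v where uv: "\<not> int p dvd u" "\<not> int p dvd v" "hecke_sum (p ^ e * m) = u * hecke_sum m"
      "hecke_sum (p ^ Suc e * m) = v * hecke_sum m" by blast
    have "p ^ Suc e * m div p = p ^ e * m" "p dvd p ^ Suc e * m"
      using assms(1) by (simp_all add: mult.assoc)
    then have "hecke_sum (p ^ Suc (Suc e) * m) = (h * v - chi3 p * int p ^ 3 * u) * hecke_sum m"
      using split[of "p ^ Suc e * m"] uv by (simp add: h_def algebra_simps)
    moreover have "\<not> int p dvd h * v - chi3 p * int p ^ 3 * u"
    proof
      assume "int p dvd h * v - chi3 p * int p ^ 3 * u"
      then have "int p dvd (h * v - chi3 p * int p ^ 3 * u) + int p * (chi3 p * int p ^ 2 * u)"
        by (intro dvd_add) auto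
      then have "int p dvd h * v" by (simp add: power2_eq_square power3_eq_cube algebra_simps)
      then show False using uv ndvd p prime_dvd_mult_iff h_def by blast
    qed
    ultimately show ?case using uv by blast
  qed
  then show thesis using that by blast
qed

text \<open>A prime factor of m is split or inert. Removing the full power of a split prime, or the
  square of an inert one, changes the sum only by a nonzero factor and keeps the hypotheses, until m
  = 1.\<close>

lemma hecke_sum_nonzero:
  assumes "m > 0" "\<not> 3 dvd m" "\<And>p. prime p \<Longrightarrow> p mod 3 = 2 \<Longrightarrow> even (multiplicity p m)"
  shows "hecke_sum m \<noteq> 0"
  using assms
proof (induction m rule: less_induct)
  case (less m)
  show ?case
  proof (cases "m = 1")
    case True
    then show ?thesis using hecke_sum_1 by simp
  next
    case False
    then obtain p where p: "prime p" "p dvd m" using prime_factor_nat by blast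
    obtain k where mk: "m = p ^ multiplicity p m * k" "\<not> p dvd k"
      using multiplicity_decompose'[of m p] less.prems p by (metis not_prime_1 nat_dvd_1_iff_1 not_prime_unit gr_implies_not0)
    have e0: "multiplicity p m > 0" using p less.prems prime_multiplicity_gt_zero_iff by blast
    have "p \<noteq> 3" using p less.prems by auto
    then have "p mod 3 \<noteq> 0"
      using p primes_dvd_imp_eq[of 3 p] by (auto simp: dvd_eq_mod_eq_0)
    then consider "p mod 3 = 1" | "p mod 3 = 2" by linarith
    then show ?thesis
    proof cases
      case 1
      then obtain u where u: "\<not> int p dvd u" "hecke_sum m = u * hecke_sum k"
        using hecke_sum_split_prime_power[OF p(1) _ mk(2)] mk(1) by metis
      have k0: "k > 0" using mk less.prems by (cases k) auto
      have "k < m"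
        using one_less_power[OF prime_gt_1_nat[OF p(1)] e0] k0 by (subst mk(1)) simp
      moreover have "\<not> 3 dvd k" using mk less.prems by (metis dvd_mult)
      moreover have "even (multiplicity q k)" if q: "prime q" "q mod 3 = 2" for q
      proof -
        have "q \<noteq> p" using q 1 by auto
        then have "\<not> q dvd p ^ multiplicity p m"
          using p q primes_dvd_imp_eq prime_dvd_power by blast
        then have "multiplicity q (p ^ multiplicity p m * k) = multiplicity q k"
          using p q k0 by (simp add: prime_elem_multiplicity_mult_distrib not_dvd_imp_multiplicity_0 prime_gt_0_nat)
        then show ?thesis using less.prems q mk(1) by metis
      qed
      ultimately have "hecke_sum k \<noteq> 0" using less.IH k0 by blast
      moreover have "u \<noteq> 0" using u by auto
      ultimately show ?thesis using u by simp
    next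
      case 2
      then have "even (multiplicity p m)" using less.prems p by blast
      with e0 have "multiplicity p m \<ge> 2" by (cases "multiplicity p m = 1") auto
      then have "p ^ 2 dvd m" using multiplicity_dvd'[of 2 p m] by simp
      then obtain n where n: "m = p * (p * n)" by (metis dvdE mult.assoc power2_eq_square)
      then have n0: "n > 0" using less.prems by (cases n) auto
      have "n < m" unfolding n using n0 one_less_mult[of p p] prime_gt_1_nat[OF p(1)] by simp
      moreover have "\<not> 3 dvd n" using n less.prems by (metis dvd_mult)
      moreover have "even (multiplicity q n)" if q: "prime q" "q mod 3 = 2" for q
      proof -
        have "multiplicity q m = 2 * multiplicity q p + multiplicity q n"
          unfolding n using p q n0 by (simp add: prime_elem_multiplicity_mult_distrib prime_gt_0_nat)
        moreover have "even (multiplicity q m)" using less.prems q by blast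
        ultimately show ?thesis by (metis even_add dvd_triv_left)
      qed
      ultimately have "hecke_sum n \<noteq> 0" using less.IH n0 by blast
      then show ?thesis using hecke_sum_inert_prime[OF p(1) 2, of n] n p by simp
    qed
  qed
qed

section \<open>Euler products and Gaussian binomials\<close>

hide_const (open) up_ring.coeff up_ring.monom

section \<open>Truncated power series and Euler products\<close>

text \<open>Congruence modulo X^K. It takes the place of limits: infinite series and products are
  compared with finite ones for every K.\<close>

definition fps_eq_upto :: "nat \<Rightarrow> rat fps \<Rightarrow> rat fps \<Rightarrow> bool" where
  "fps_eq_upto K f g \<longleftrightarrow> (\<forall>k<K. fps_nth f k = fps_nth g k)"

lemma fps_eq_upto_refl [simp]: "fps_eq_upto K f f"
  by (simp add: fps_eq_upto_def)

lemma fps_eq_upto_sym: "fps_eq_upto K f g \<Longrightarrow> fps_eq_upto K g f"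
  by (simp add: fps_eq_upto_def)

lemma fps_eq_upto_trans [trans]:
  "fps_eq_upto K f g \<Longrightarrow> fps_eq_upto K g h \<Longrightarrow> fps_eq_upto K f h"
  by (simp add: fps_eq_upto_def)

lemma fps_eq_upto_mult:
  "fps_eq_upto K f f' \<Longrightarrow> fps_eq_upto K g g' \<Longrightarrow> fps_eq_upto K (f * g) (f' * g')"
  by (simp add: fps_eq_upto_def fps_mult_nth)

lemma fps_eq_upto_power: "fps_eq_upto K f g \<Longrightarrow> fps_eq_upto K (f ^ n) (g ^ n)"
  by (induction n) (simp_all add: fps_eq_upto_mult)

lemma fps_eq_upto_sum:
  "(\<And>i. i \<in> A \<Longrightarrow> fps_eq_upto K (f i) (g i)) \<Longrightarrow> fps_eq_upto K (sum f A) (sum g A)"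
  by (simp add: fps_eq_upto_def fps_sum_nth)

lemma fps_eqI_upto: "(\<And>K. fps_eq_upto K f g) \<Longrightarrow> f = g"
  by (rule fps_ext) (auto simp: fps_eq_upto_def)

lemma fps_eq_upto_X_power_0: "K \<le> n \<Longrightarrow> fps_eq_upto K (f * fps_X ^ n) 0"
  by (auto simp: fps_eq_upto_def fps_X_power_mult_right_nth)

lemma fps_eq_upto_cancel:
  assumes "fps_nth h 0 \<noteq> 0" "fps_eq_upto K (h * f) (h * g)"
  shows "fps_eq_upto K f g"
proof -
  have "fps_eq_upto K (inverse h * (h * f)) (inverse h * (h * g))"
    by (rule fps_eq_upto_mult[OF fps_eq_upto_refl assms(2)])
  moreover have "inverse h * h = 1" using assms inverse_mult_eq_1 by blast
  ultimately show ?thesis by (simp only: mult.assoc[symmetric] mult_1_left)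
qed

definition euler_prod :: "nat \<Rightarrow> nat \<Rightarrow> rat fps" where
  "euler_prod d N = (\<Prod>l<N. 1 - fps_X ^ (d * Suc l))"

text \<open>For d > 0 this is the infinite product of the 1 - X^(dl), l \<ge> 1: the factors after
  the n-th do not affect the coefficient of X^n.\<close>

definition euler_fps :: "nat \<Rightarrow> rat fps" where
  "euler_fps d = Abs_fps (\<lambda>n. fps_nth (euler_prod d n) n)"

lemma euler_prod_0 [simp]: "euler_prod d 0 = 1"
  by (simp add: euler_prod_def)

lemma euler_prod_Suc: "euler_prod d (Suc N) = euler_prod d N * (1 - fps_X ^ (d * Suc N))"
  by (simp add: euler_prod_def)

lemma euler_prod_nth_0: "d > 0 \<Longrightarrow> fps_nth (euler_prod d N) 0 = 1"
  by (induction N) (simp_all add: euler_prod_Suc)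

lemma euler_prod_nonzero: "d > 0 \<Longrightarrow> euler_prod d N \<noteq> 0"
  using euler_prod_nth_0[of d N] by auto

lemma euler_fps_nth_0: "fps_nth (euler_fps d) 0 = 1"
  by (simp add: euler_fps_def)

lemma euler_prod_stable:
  assumes "d > 0" "n \<le> N"
  shows "fps_nth (euler_prod d N) n = fps_nth (euler_prod d n) n"
  using assms(2)
proof (induction N rule: dec_induct)
  case (step N)
  have "fps_nth (euler_prod d N * fps_X ^ (d * Suc N)) n = 0"
  proof -
    have "d * Suc N \<ge> 1 * Suc N" using assms(1) by (intro mult_le_mono1) auto
    then have "n < d * Suc N" using step by simp
    then show ?thesis by (simp add: fps_X_power_mult_right_nth del: mult_Suc_right)
  qed
  then show ?case using step by (simp add: euler_prod_Suc right_diff_distrib del: mult_Suc_right)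
qed auto

lemma euler_prod_eq_upto:
  assumes "d > 0" "K \<le> Suc N"
  shows "fps_eq_upto K (euler_prod d N) (euler_fps d)"
  unfolding fps_eq_upto_def euler_fps_def fps_nth_Abs_fps
  using assms by (intro allI impI euler_prod_stable) auto

section \<open>Gaussian binomials\<close>

text \<open>The base is q = X^d. The q-Pascal rule serves as definition so that no division
  occurs.\<close>

fun gauss_binomial :: "nat \<Rightarrow> nat \<Rightarrow> nat \<Rightarrow> rat fps" where
  "gauss_binomial d n 0 = 1"
| "gauss_binomial d 0 (Suc k) = 0"
| "gauss_binomial d (Suc n) (Suc k) =
     gauss_binomial d n k + fps_X ^ (d * Suc k) * gauss_binomial d n (Suc k)"

lemma gauss_binomial_eq_0: "n < k \<Longrightarrow> gauss_binomial d n k = 0"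
  by (induction d n k rule: gauss_binomial.induct) auto

text \<open>The quotient formula for Gaussian binomials, cleared of denominators. The induction step
  rests on (1 - q^(k+1)) + q^(k+1) (1 - q^(n-k)) = 1 - q^(n+1).\<close>

lemma gauss_binomial_mult_euler_prod:
  "k \<le> n \<Longrightarrow> gauss_binomial d n k * (euler_prod d k * euler_prod d (n - k)) = euler_prod d n"
proof (induction d n k rule: gauss_binomial.induct)
  case (3 d n k)
  show ?case
  proof (cases "k = n")
    case True
    then show ?thesis using 3 by (simp add: gauss_binomial_eq_0 euler_prod_Suc mult.assoc[symmetric])
  next
    case False
    with 3 have kn: "Suc k \<le> n" by simp
    have 1: "gauss_binomial d n k * (euler_prod d k * euler_prod d (n - k)) = euler_prod d n"
      using 3 by simp
    have 2: "gauss_binomial d n (Suc k) * (euler_prod d (Suc k) * euler_prod d (n - Suc k)) = euler_prod d n"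
      using 3 kn by simp
    have nk: "n - k = Suc (n - Suc k)" using kn by simp
    have e: "fps_X ^ (d * Suc n) = (fps_X :: rat fps) ^ (d * Suc k) * fps_X ^ (d * Suc (n - Suc k))"
    proof -
      have "Suc n = Suc k + Suc (n - Suc k)" using kn by simp
      then have "d * Suc n = d * Suc k + d * Suc (n - Suc k)" by (metis distrib_left)
      then show ?thesis by (simp only: power_add)
    qed
    have "gauss_binomial d (Suc n) (Suc k) * (euler_prod d (Suc k) * euler_prod d (Suc n - Suc k)) =
      gauss_binomial d n k * (euler_prod d k * euler_prod d (n - k)) * (1 - fps_X ^ (d * Suc k)) +
      fps_X ^ (d * Suc k) * (gauss_binomial d n (Suc k) * (euler_prod d (Suc k) * euler_prod d (n - Suc k))) * 
        (1 - fps_X ^ (d * Suc (n - Suc k)))"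
      unfolding gauss_binomial.simps euler_prod_Suc diff_Suc_Suc nk by (simp only: algebra_simps)
    also have "\<dots> = euler_prod d (Suc n)"
      unfolding 1 2 unfolding euler_prod_Suc e by (simp only: algebra_simps) simp
    finally show ?thesis .
  qed
qed auto

text \<open>The second q-Pascal rule. Both sides agree after multiplication by the nonzero
  denominators of the quotient formula.\<close>

lemma gauss_binomial_Suc_Suc':
  assumes "d > 0" "k \<le> n"
  shows "gauss_binomial d (Suc n) (Suc k) =
    fps_X ^ (d * (n - k)) * gauss_binomial d n k + gauss_binomial d n (Suc k)"
proof (cases "k = n")
  case True
  have "gauss_binomial d n n = 1" for n
    by (induction n) (simp_all add: gauss_binomial_eq_0)
  then show ?thesis using True by (simp add: gauss_binomial_eq_0)
next
  case False
  with assms have kn: "Suc k \<le> n" by simp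
  define P where "P = euler_prod d (Suc k) * euler_prod d (n - k)"
  have nk: "n - k = Suc (n - Suc k)" using kn by simp
  have 1: "gauss_binomial d n k * (euler_prod d k * euler_prod d (n - k)) = euler_prod d n"
    and 2: "gauss_binomial d n (Suc k) * (euler_prod d (Suc k) * euler_prod d (n - Suc k)) = euler_prod d n"
    and 3: "gauss_binomial d (Suc n) (Suc k) * P = euler_prod d (Suc n)"
    using gauss_binomial_mult_euler_prod[of k n d] gauss_binomial_mult_euler_prod[of "Suc k" n d]
      gauss_binomial_mult_euler_prod[of "Suc k" "Suc n" d] kn by (simp_all add: P_def)
  have e: "fps_X ^ (d * Suc n) = (fps_X :: rat fps) ^ (d * (n - k)) * fps_X ^ (d * Suc k)"
  proof -
    have "Suc n = (n - k) + Suc k" using kn by simp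
    then have "d * Suc n = d * (n - k) + d * Suc k" by (metis distrib_left)
    then show ?thesis by (simp only: power_add)
  qed
  have "(fps_X ^ (d * (n - k)) * gauss_binomial d n k + gauss_binomial d n (Suc k)) * P =
     fps_X ^ (d * (n - k)) * (gauss_binomial d n k * (euler_prod d k * euler_prod d (n - k))) * (1 - fps_X ^ (d * Suc k)) +
     (gauss_binomial d n (Suc k) * (euler_prod d (Suc k) * euler_prod d (n - Suc k))) * (1 - fps_X ^ (d * (n - k)))"
    unfolding P_def nk euler_prod_Suc by (simp only: algebra_simps)
  also have "\<dots> = gauss_binomial d (Suc n) (Suc k) * P"
    unfolding 1 2 3 unfolding euler_prod_Suc e by (simp only: algebra_simps) simp
  finally show ?thesis
    using assms euler_prod_nonzero by (simp add: P_def del: gauss_binomial.simps)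
qed

text \<open>As k and n - k grow, the Gaussian binomial tends to the reciprocal of the Euler
  product.\<close>

lemma gauss_binomial_eq_upto:
  assumes "d > 0" "k \<le> n" "K \<le> k" "K \<le> n - k"
  shows "fps_eq_upto K (euler_fps d * gauss_binomial d n k) 1"
proof -
  let ?e = "euler_fps d"
  have "fps_eq_upto K (gauss_binomial d n k * (euler_prod d k * euler_prod d (n - k)))
          (gauss_binomial d n k * (?e * ?e))"
    using assms by (intro fps_eq_upto_mult euler_prod_eq_upto) auto
  moreover have "fps_eq_upto K (euler_prod d n) ?e"
    using assms by (intro euler_prod_eq_upto) auto
  ultimately have "fps_eq_upto K (gauss_binomial d n k * (?e * ?e)) ?e"
    using gauss_binomial_mult_euler_prod[of k n d] assms fps_eq_upto_sym fps_eq_upto_trans by metis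
  then have "fps_eq_upto K (?e * (?e * gauss_binomial d n k)) (?e * 1)"
    by (simp add: mult_ac)
  then show ?thesis by (rule fps_eq_upto_cancel[rotated]) (simp add: euler_fps_nth_0)
qed

section \<open>The finite Jacobi triple product\<close>

text \<open>The series \<open>\<Sum>\<^sub>i c\<^sub>i X\<^bsup>g(i)\<^esup>\<close>. A coefficient with infinitely many contributions gets the junk value 0.\<close>
definition qsum :: "('i \<Rightarrow> rat) \<Rightarrow> ('i \<Rightarrow> nat) \<Rightarrow> rat fps" where
  "qsum c g = Abs_fps (\<lambda>k. \<Sum>i | c i \<noteq> 0 \<and> g i = k. c i)"

definition qsummable :: "('i \<Rightarrow> rat) \<Rightarrow> ('i \<Rightarrow> nat) \<Rightarrow> bool" where
  "qsummable c g \<longleftrightarrow> (\<forall>k. finite {i. c i \<noteq> 0 \<and> g i = k})"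

lemma qsum_nth: "fps_nth (qsum c g) k = (\<Sum>i | c i \<noteq> 0 \<and> g i = k. c i)"
  by (simp add: qsum_def)

lemma qsum_nth':
  assumes "finite A" "\<And>i. c i \<noteq> 0 \<Longrightarrow> g i = k \<Longrightarrow> i \<in> A" "\<And>i. i \<in> A \<Longrightarrow> g i = k"
  shows "fps_nth (qsum c g) k = sum c A"
  unfolding qsum_nth using assms by (intro sum.mono_neutral_left) auto

text \<open>The exponents are compared on the support of c only, since later changes of variables
  match them just on one residue class.\<close>

lemma qsum_reindex:
  assumes "bij h" "\<And>i. c' (h i) = c i" "\<And>i. c i \<noteq> 0 \<Longrightarrow> g' (h i) = g i"
  shows "qsum c g = qsum c' g'"
proof (rule fps_ext)
  fix k
  have "{i. c' i \<noteq> 0 \<and> g' i = k} = h ` {i. c i \<noteq> 0 \<and> g i = k}"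
  proof (intro subset_antisym subsetI)
    fix x assume x: "x \<in> {i. c' i \<noteq> 0 \<and> g' i = k}"
    obtain y where y: "x = h y" using assms(1) by (metis bij_pointE)
    then have "c y \<noteq> 0" "g y = k" using x assms(2)[of y] assms(3)[of y] by auto
    then show "x \<in> h ` {i. c i \<noteq> 0 \<and> g i = k}" using y by blast
  qed (use assms(2,3) in auto)
  moreover have "inj_on h {i. c i \<noteq> 0 \<and> g i = k}"
    using assms(1) bij_is_inj inj_on_subset by blast
  ultimately show "fps_nth (qsum c g) k = fps_nth (qsum c' g') k"
    by (simp add: qsum_nth sum.reindex assms(2))
qed

lemma qsum_uminus: "qsum (\<lambda>i. - c i) g = - qsum c g"
  by (rule fps_ext) (simp add: qsum_nth sum_negf)

lemma qsum_scale: "qsum (\<lambda>i. r * c i) g = fps_const r * qsum c g"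
proof (rule fps_ext)
  fix k
  show "fps_nth (qsum (\<lambda>i. r * c i) g) k = fps_nth (fps_const r * qsum c g) k"
    by (cases "r = 0") (simp_all add: qsum_nth sum_distrib_left)
qed

lemma qsum_add:
  assumes "\<And>k. finite {i. g i = k}"
  shows "qsum (\<lambda>i. c i + c' i) g = qsum c g + qsum c' g"
proof (rule fps_ext)
  fix k
  have "fps_nth (qsum c g) k = sum c {i. g i = k}" for c :: "'a \<Rightarrow> rat"
    using assms by (intro qsum_nth') auto
  then show "fps_nth (qsum (\<lambda>i. c i + c' i) g) k = fps_nth (qsum c g + qsum c' g) k"
    by (simp add: sum.distrib)
qed

text \<open>The substitution \<open>h\<close> turns the series into its own negative.\<close>

lemma qsum_eq_0_involution:
  assumes "bij h" "\<And>i. c (h i) = - c i" "\<And>i. c i \<noteq> 0 \<Longrightarrow> g (h i) = g i"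
  shows "qsum c g = 0"
proof -
  have "qsum (\<lambda>i. - c i) g = qsum c g"
    using assms by (intro qsum_reindex[of h]) auto
  then have "- fps_nth (qsum c g) k = fps_nth (qsum c g) k" for k
    using arg_cong[of _ _ "\<lambda>f. fps_nth f k"] by (simp add: qsum_uminus)
  then show ?thesis by (intro fps_ext) (simp add: eq_neg_iff_add_eq_0 flip: minus_equation_iff)
qed

lemma qsummable_mult:
  assumes "qsummable c g" "qsummable c' g'"
  shows "qsummable (\<lambda>(i, j). c i * c' j) (\<lambda>(i, j). g i + g' j)"
  unfolding qsummable_def
proof
  fix k
  let ?A = "\<lambda>n. {i. c i \<noteq> 0 \<and> g i = n}" and ?B = "\<lambda>n. {i. c' i \<noteq> 0 \<and> g' i = n}"
  have "finite (\<Union>n\<in>{..k}. ?A n \<times> ?B (k - n))"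
    using assms by (intro finite_UN_I finite_cartesian_product) (auto simp: qsummable_def)
  then show "finite {x. (case x of (i, j) \<Rightarrow> c i * c' j) \<noteq> 0 \<and> (case x of (i, j) \<Rightarrow> g i + g' j) = k}"
    by (rule rev_finite_subset) force
qed

lemma qsum_mult:
  assumes "qsummable c g" "qsummable c' g'"
  shows "qsum c g * qsum c' g' = qsum (\<lambda>(i, j). c i * c' j) (\<lambda>(i, j). g i + g' j)"
proof (rule fps_ext)
  fix k
  let ?A = "\<lambda>n. {i. c i \<noteq> 0 \<and> g i = n}" and ?B = "\<lambda>n. {i. c' i \<noteq> 0 \<and> g' i = n}"
  have fin: "finite (?A n)" "finite (?B n)" for n using assms by (auto simp: qsummable_def)
  have "fps_nth (qsum c g * qsum c' g') k = (\<Sum>n\<in>{..k}. \<Sum>x\<in>?A n \<times> ?B (k - n). c (fst x) * c' (snd x))"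
    by (simp add: fps_mult_nth qsum_nth sum_product sum.cartesian_product atLeast0AtMost case_prod_unfold)
  also have "\<dots> = (\<Sum>x\<in>(\<Union>n\<in>{..k}. ?A n \<times> ?B (k - n)). c (fst x) * c' (snd x))"
    using fin by (subst sum.UNION_disjoint) auto
  also have "(\<Union>n\<in>{..k}. ?A n \<times> ?B (k - n)) =
      {x. (case x of (i, j) \<Rightarrow> c i * c' j) \<noteq> 0 \<and> (case x of (i, j) \<Rightarrow> g i + g' j) = k}"
    by force
  finally show "fps_nth (qsum c g * qsum c' g') k =
      fps_nth (qsum (\<lambda>(i, j). c i * c' j) (\<lambda>(i, j). g i + g' j)) k"
    by (simp add: qsum_nth case_prod_unfold)
qed

lemma qsum_eq_upto:
  assumes "finite F" "\<And>i. c i \<noteq> 0 \<Longrightarrow> g i < K \<Longrightarrow> i \<in> F"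
  shows "fps_eq_upto K (qsum c g) (\<Sum>i\<in>F. fps_const (c i) * fps_X ^ g i)"
  unfolding fps_eq_upto_def
proof (intro allI impI)
  fix k assume k: "k < K"
  have "fps_nth (\<Sum>i\<in>F. fps_const (c i) * fps_X ^ g i) k = (\<Sum>i\<in>F. if g i = k then c i else 0)"
    by (auto simp: fps_sum_nth fps_X_power_nth intro!: sum.cong)
  also have "\<dots> = sum c {i\<in>F. g i = k}"
    using assms(1) by (simp add: sum.inter_filter)
  also have "\<dots> = fps_nth (qsum c g) k"
    using assms k by (intro qsum_nth'[symmetric]) auto
  finally show "fps_nth (qsum c g) k = fps_nth (\<Sum>i\<in>F. fps_const (c i) * fps_X ^ g i) k" by simp
qed

section \<open>Triangular numbers and theta exponents\<close>

definition tri :: "int \<Rightarrow> nat" where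
  "tri n = nat (n * (n + 1) div 2)"

lemma two_tri: "2 * int (tri n) = n * (n + 1)"
proof -
  have "0 \<le> n * (n + 1)" by (cases "n \<ge> 0") (auto simp: mult_nonpos_nonpos)
  moreover have "even (n * (n + 1))" by simp
  ultimately show ?thesis unfolding tri_def by (simp add: pos_imp_zdiv_nonneg_iff)
qed

lemma tri_neg: "tri (- 1 - n) = tri n"
  using two_tri[of n] two_tri[of "- 1 - n"] by (simp add: algebra_simps)

lemma abs_le_tri: "\<bar>n\<bar> \<le> int (tri n) + 1"
proof -
  have "0 \<le> (\<bar>n\<bar> - 1) * (\<bar>n\<bar> - 2)"
  proof (cases "\<bar>n\<bar> \<ge> 2")
    case False
    then have "\<bar>n\<bar> = 0 \<or> \<bar>n\<bar> = 1" by linarith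
    then show ?thesis by auto
  qed auto
  then have "2 * \<bar>n\<bar> \<le> \<bar>n\<bar> * (\<bar>n\<bar> - 1) + 2" by (simp add: algebra_simps)
  also have "\<bar>n\<bar> * (\<bar>n\<bar> - 1) \<le> n * (n + 1)" by (cases "n \<ge> 0") (auto simp: algebra_simps)
  finally show ?thesis using two_tri[of n] by linarith
qed

text \<open>The exponent \<alpha> n(n+1)/2 + \<beta> n(n-1)/2 of Ramanujan's theta function
  f(X^\<alpha>, X^\<beta>). The pair (1, 0) gives triangular and (2, 1) generalized pentagonal
  numbers.\<close>

definition theta_exp :: "nat \<Rightarrow> nat \<Rightarrow> int \<Rightarrow> nat" where
  "theta_exp \<alpha> \<beta> n = \<alpha> * tri n + \<beta> * tri (- n)"

lemma two_theta_exp: "2 * int (theta_exp \<alpha> \<beta> n) = int (\<alpha> + \<beta>) * n\<^sup>2 + (int \<alpha> - int \<beta>) * n"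
proof -
  have "2 * int (theta_exp \<alpha> \<beta> n) = int \<alpha> * (2 * int (tri n)) + int \<beta> * (2 * int (tri (- n)))"
    by (simp add: theta_exp_def algebra_simps)
  then show ?thesis unfolding two_tri by (simp add: algebra_simps power2_eq_square)
qed

lemma theta_exp_Suc: "int (theta_exp \<alpha> \<beta> (n + 1)) = int (theta_exp \<alpha> \<beta> n) + int (\<alpha> + \<beta>) * n + int \<alpha>"
  using two_theta_exp[of \<alpha> \<beta> n] two_theta_exp[of \<alpha> \<beta> "n + 1"] by (simp add: algebra_simps power2_eq_square)

lemma theta_exp_0 [simp]: "theta_exp \<alpha> \<beta> 0 = 0"
  using two_theta_exp[of \<alpha> \<beta> 0] by simp

lemma abs_le_theta_exp:
  assumes "\<alpha> + \<beta> > 0"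
  shows "\<bar>n\<bar> \<le> int (theta_exp \<alpha> \<beta> n) + 1"
proof (cases "\<alpha> = 0")
  case True
  then have "tri (- n) \<le> theta_exp \<alpha> \<beta> n" using assms by (simp add: theta_exp_def)
  then show ?thesis using abs_le_tri[of "- n"] by simp
next
  case False
  then have "1 * tri n \<le> \<alpha> * tri n" by (intro mult_le_mono1) simp
  then have "tri n \<le> theta_exp \<alpha> \<beta> n" unfolding theta_exp_def by linarith
  then show ?thesis using abs_le_tri[of n] by simp
qed

lemma finite_theta_exp:
  assumes "\<alpha> + \<beta> > 0"
  shows "finite {n. theta_exp \<alpha> \<beta> n \<le> k}"
proof (rule finite_subset)
  show "{n. theta_exp \<alpha> \<beta> n \<le> k} \<subseteq> {- int k - 1..int k + 1}"
  proof
    fix n assume "n \<in> {n. theta_exp \<alpha> \<beta> n \<le> k}"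
    then have "\<bar>n\<bar> \<le> int k + 1" using abs_le_theta_exp[OF assms, of n] by simp
    then show "n \<in> {- int k - 1..int k + 1}" by auto
  qed
qed simp

section \<open>The truncated triple product and its limit\<close>

text \<open>The Jacobi triple product with base \<open>X\<^bsup>\<alpha>+\<beta>\<^esup>\<close> truncated to \<open>a\<close> and \<open>b\<close> factors, as a polynomial in \<open>z\<close>; to avoid
  negative powers, the factors \<open>1 + z\<^sup>-\<^sup>1 X\<^sup>k\<close> are multiplied by \<open>z\<close>.\<close>
definition jacobi_poly :: "nat \<Rightarrow> nat \<Rightarrow> nat \<Rightarrow> nat \<Rightarrow> rat fps poly" where
  "jacobi_poly \<alpha> \<beta> a b = (\<Prod>l<a. [:1, fps_X ^ (\<alpha> + (\<alpha> + \<beta>) * l):]) *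
     (\<Prod>l<b. [:fps_X ^ (\<beta> + (\<alpha> + \<beta>) * l), 1:])"

text \<open>The index j stands for the power j - b of z, because b factors were multiplied by z. A
  factor 1 + zX^k is adjoined by the second q-Pascal rule, a factor z + X^k by the defining one;
  \<open>theta_exp_Suc\<close> matches the exponents.\<close>

lemma coeff_jacobi_poly:
  assumes d: "d = \<alpha> + \<beta>" "d > 0"
  shows "coeff (jacobi_poly \<alpha> \<beta> a b) j = 
    gauss_binomial d (a + b) j * fps_X ^ theta_exp \<alpha> \<beta> (int j - int b)"
proof (induction b arbitrary: j)
  case 0
  show ?case
  proof (induction a arbitrary: j)
    case 0
    then show ?case by (cases j) (auto simp: jacobi_poly_def)
  next
    case (Suc a)
    have *: "jacobi_poly \<alpha> \<beta> (Suc a) 0 = [:1, fps_X ^ (\<alpha> + d * a):] * jacobi_poly \<alpha> \<beta> a 0"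
      by (simp add: jacobi_poly_def d mult.commute)
    show ?case
    proof (cases j)
      case 0
      then show ?thesis using Suc[of 0] unfolding * by simp
    next
      case j: (Suc i)
      have "coeff (jacobi_poly \<alpha> \<beta> (Suc a) 0) j =
        gauss_binomial d a (Suc i) * fps_X ^ theta_exp \<alpha> \<beta> (int i + 1) +
        gauss_binomial d a i * fps_X ^ (\<alpha> + d * a + theta_exp \<alpha> \<beta> (int i))"
        unfolding * using Suc[of i] Suc[of j] by (simp add: j power_add add_ac mult_ac)
      also have "\<dots> = gauss_binomial d (Suc a) (Suc i) * fps_X ^ theta_exp \<alpha> \<beta> (int i + 1)"
      proof (cases "i \<le> a")
        case True
        have "int (d * (a - i)) + int (theta_exp \<alpha> \<beta> (int i + 1)) =
            int (\<alpha> + d * a + theta_exp \<alpha> \<beta> (int i))"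
          unfolding theta_exp_Suc of_nat_mult of_nat_add using True d(1)
          by (simp add: algebra_simps of_nat_diff)
        then have "d * (a - i) + theta_exp \<alpha> \<beta> (int i + 1) = \<alpha> + d * a + theta_exp \<alpha> \<beta> (int i)" by linarith
        then have "fps_X ^ (\<alpha> + d * a + theta_exp \<alpha> \<beta> (int i)) =
          fps_X ^ (d * (a - i)) * (fps_X :: rat fps) ^ theta_exp \<alpha> \<beta> (int i + 1)"
          by (metis power_add)
        then show ?thesis
          by (simp only: gauss_binomial_Suc_Suc'[OF d(2) True]) (simp add: algebra_simps)
      qed (simp add: gauss_binomial_eq_0)
      finally show ?thesis by (simp add: j add.commute)
    qed
  qed
next
  case (Suc b)
  have *: "jacobi_poly \<alpha> \<beta> a (Suc b) = [:fps_X ^ (\<beta> + d * b), 1:] * jacobi_poly \<alpha> \<beta> a b"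
    unfolding jacobi_poly_def prod.lessThan_Suc d(1) by (simp only: mult_ac)
  show ?case
  proof (cases j)
    case 0
    have "int (theta_exp \<alpha> \<beta> (- int b)) = int (theta_exp \<alpha> \<beta> (- int b - 1)) + int d * (- int b - 1) + int \<alpha>"
      using theta_exp_Suc[of \<alpha> \<beta> "- int b - 1"] d by simp
    then have "int (\<beta> + d * b + theta_exp \<alpha> \<beta> (- int b)) = int (theta_exp \<alpha> \<beta> (- int b - 1))"
      using d by (simp add: algebra_simps)
    moreover have "int 0 - int (Suc b) = - int b - 1" by simp
    ultimately have "theta_exp \<alpha> \<beta> (int 0 - int (Suc b)) = \<beta> + d * b + theta_exp \<alpha> \<beta> (- int b)"
      by (metis of_nat_eq_iff)
    then show ?thesis unfolding * 0 using Suc[of 0] by (simp add: power_add mult.assoc)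
  next
    case j: (Suc i)
    define n where "n = int i - int b"
    have n: "int j - int b = n + 1" "int j - int (Suc b) = n" by (simp_all add: j n_def)
    have "int (\<beta> + d * b + theta_exp \<alpha> \<beta> (n + 1)) = int (d * Suc i + theta_exp \<alpha> \<beta> n)"
      unfolding of_nat_add theta_exp_Suc using d by (simp add: n_def algebra_simps)
    then have "\<beta> + d * b + theta_exp \<alpha> \<beta> (n + 1) = d * Suc i + theta_exp \<alpha> \<beta> n" by linarith
    then have e: "fps_X ^ (\<beta> + d * b) * fps_X ^ theta_exp \<alpha> \<beta> (n + 1) =
        fps_X ^ (d * Suc i) * (fps_X :: rat fps) ^ theta_exp \<alpha> \<beta> n"
      by (metis power_add)
    have "coeff (jacobi_poly \<alpha> \<beta> a (Suc b)) j =
       fps_X ^ (\<beta> + d * b) * coeff (jacobi_poly \<alpha> \<beta> a b) j + coeff (jacobi_poly \<alpha> \<beta> a b) i"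
      unfolding * by (simp add: j)
    also have "\<dots> = gauss_binomial d (a + b) j * (fps_X ^ (\<beta> + d * b) * fps_X ^ theta_exp \<alpha> \<beta> (n + 1)) +
       gauss_binomial d (a + b) i * fps_X ^ theta_exp \<alpha> \<beta> n"
      unfolding Suc[of j] Suc[of i] n(1) n_def[symmetric] by (simp only: mult_ac)
    also have "\<dots> = gauss_binomial d (a + Suc b) j * fps_X ^ theta_exp \<alpha> \<beta> n"
      unfolding e by (simp add: j algebra_simps)
    finally show ?thesis by (simp only: n)
  qed
qed

text \<open>Near the middle the Gaussian binomial is the reciprocal of the Euler product modulo X^K.
  Far from the middle the theta exponent is at least K and both sides vanish.\<close>

lemma gauss_binomial_theta_eq_upto:
  assumes d: "d = \<alpha> + \<beta>" "d > 0" and N: "2 * K \<le> N" and k: "k \<le> 2 * N"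
  shows "fps_eq_upto K (euler_fps d * (gauss_binomial d (2 * N) k * fps_X ^ theta_exp \<alpha> \<beta> (int k - int N)))
    (fps_X ^ theta_exp \<alpha> \<beta> (int k - int N))"
proof (cases "\<bar>int k - int N\<bar> \<le> int N - int K")
  case True
  then have "K \<le> k" "K \<le> 2 * N - k" using k by linarith+
  then have "fps_eq_upto K (euler_fps d * gauss_binomial d (2 * N) k) 1"
    by (rule gauss_binomial_eq_upto[OF d(2) k])
  from fps_eq_upto_mult[OF this fps_eq_upto_refl] show ?thesis
    by (simp add: mult.assoc)
next
  case False
  then have "K \<le> theta_exp \<alpha> \<beta> (int k - int N)"
    using abs_le_theta_exp[of \<alpha> \<beta> "int k - int N"] d N by linarith
  then have 0: "fps_eq_upto K (f * fps_X ^ theta_exp \<alpha> \<beta> (int k - int N)) 0" for f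
    by (rule fps_eq_upto_X_power_0)
  from fps_eq_upto_trans[OF 0[of "euler_fps d * gauss_binomial d (2 * N) k"] fps_eq_upto_sym[OF 0[of 1]]]
  show ?thesis by (simp only: mult.assoc mult_1_left)
qed

definition alt :: "int \<Rightarrow> rat" where
  "alt n = (if even n then 1 else - 1)"

lemma alt_add: "alt (m + n) = alt m * alt n"
  by (simp add: alt_def)

lemma alt_diff: "alt (m - n) = alt m * alt n"
  by (simp add: alt_def)

lemma alt_minus [simp]: "alt (- n) = alt n"
  by (simp add: alt_def)

lemma alt_1 [simp]: "alt 1 = - 1"
  by (simp add: alt_def)

lemma alt_square [simp]: "alt n * alt n = 1"
  by (simp add: alt_def)

lemma fps_const_alt: "fps_const (alt (int k - int N)) = (- 1) ^ N * (- 1) ^ k"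
  by (cases "even k"; cases "even N") (auto simp: alt_def numeral_fps_const[symmetric] simp flip: fps_const_neg)

text \<open>The limit is taken coefficient by coefficient in z, with arbitrary weights: the weight
  \<open>alt\<close> amounts to setting z = -1, and \<open>alt n * of_int n\<close> to
  differentiating there.\<close>

lemma jacobi_sum_eq_upto:
  assumes d: "d = \<alpha> + \<beta>" "d > 0" and N: "2 * K \<le> N"
  shows "fps_eq_upto K
    (euler_fps d * (\<Sum>k\<le>2 * N. fps_const (c (int k - int N)) * coeff (jacobi_poly \<alpha> \<beta> N N) k))
    (qsum c (theta_exp \<alpha> \<beta>))"
proof -
  let ?f = "\<lambda>k. int k - int N"
  have "fps_eq_upto K
    (\<Sum>k\<le>2 * N. fps_const (c (?f k)) * (euler_fps d * coeff (jacobi_poly \<alpha> \<beta> N N) k))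
    (\<Sum>k\<le>2 * N. fps_const (c (?f k)) * fps_X ^ theta_exp \<alpha> \<beta> (?f k))"
    unfolding coeff_jacobi_poly[OF d] mult_2[symmetric]
    by (intro fps_eq_upto_sum fps_eq_upto_mult[OF fps_eq_upto_refl]
        gauss_binomial_theta_eq_upto d N) simp
  also have "(\<Sum>k\<le>2 * N. fps_const (c (?f k)) * fps_X ^ theta_exp \<alpha> \<beta> (?f k)) =
      (\<Sum>n\<in>?f ` {..2 * N}. fps_const (c n) * fps_X ^ theta_exp \<alpha> \<beta> n)"
    by (subst sum.reindex) (auto simp: inj_on_def)
  also have "fps_eq_upto K \<dots> (qsum c (theta_exp \<alpha> \<beta>))"
  proof (rule fps_eq_upto_sym, rule qsum_eq_upto)
    fix n assume "theta_exp \<alpha> \<beta> n < K"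
    then have "\<bar>n\<bar> \<le> int N" using abs_le_theta_exp[of \<alpha> \<beta> n] d N by linarith
    then have "n = ?f (nat (n + int N))" "nat (n + int N) \<in> {..2 * N}" by auto
    then show "n \<in> ?f ` {..2 * N}" by blast
  qed simp
  finally show ?thesis by (simp add: sum_distrib_left mult_ac)
qed

lemma degree_jacobi_poly:
  assumes "\<alpha> + \<beta> > 0"
  shows "degree (jacobi_poly \<alpha> \<beta> a b) \<le> a + b"
  by (rule degree_le) (simp add: coeff_jacobi_poly[OF refl assms] gauss_binomial_eq_0)

lemma poly_jacobi_poly:
  assumes "\<alpha> + \<beta> > 0"
  shows "poly (jacobi_poly \<alpha> \<beta> a b) z = (\<Sum>k\<le>a + b. coeff (jacobi_poly \<alpha> \<beta> a b) k * z ^ k)"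
proof -
  let ?p = "jacobi_poly \<alpha> \<beta> a b"
  have "poly (\<Sum>k\<le>a + b. monom (coeff ?p k) k) z = (\<Sum>k\<le>a + b. coeff ?p k * z ^ k)"
    by (simp add: poly_sum poly_monom)
  then show ?thesis
    by (simp add: poly_as_sum_of_monoms'[OF degree_jacobi_poly[OF assms]])
qed

lemma poly_pderiv_jacobi_poly:
  assumes "\<alpha> + \<beta> > 0"
  shows "poly (pderiv (jacobi_poly \<alpha> \<beta> a b)) z =
    (\<Sum>k\<le>a + b. of_nat k * coeff (jacobi_poly \<alpha> \<beta> a b) k * z ^ (k - 1))"
proof -
  let ?p = "jacobi_poly \<alpha> \<beta> a b"
  have "poly (pderiv (\<Sum>k\<le>a + b. monom (coeff ?p k) k)) z =
     (\<Sum>k\<le>a + b. of_nat k * coeff ?p k * z ^ (k - 1))"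
    unfolding higher_pderiv_sum[of 1, simplified] by (simp add: pderiv_monom poly_sum poly_monom)
  then show ?thesis
    by (simp add: poly_as_sum_of_monoms'[OF degree_jacobi_poly[OF assms]])
qed

section \<open>Euler's pentagonal number theorem and Jacobi's cube\<close>

text \<open>At z = -1 the triple product for (2, 1) has the factors 1 - X^k with k prime to 3, up to
  sign; \<open>euler_fps 3\<close> supplies the multiples of 3.\<close>

lemma euler_pentagonal: "euler_fps 1 = qsum alt (theta_exp 2 1)"
proof (rule fps_eqI_upto)
  fix K :: nat
  define N where "N = 2 * K"
  define S where "S = (\<Sum>k\<le>2 * N. fps_const (alt (int k - int N)) * coeff (jacobi_poly 2 1 N N) k)"
  have "S = (- 1) ^ N * poly (jacobi_poly 2 1 N N) (- 1)"
    unfolding S_def mult_2 by (simp add: poly_jacobi_poly fps_const_alt sum_distrib_left mult_ac)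
  also have "\<dots> = (- 1) ^ N * ((\<Prod>l<N. 1 - fps_X ^ (2 + 3 * l)) * (\<Prod>l<N. - 1 * (1 - fps_X ^ (1 + 3 * l))))"
    by (simp add: jacobi_poly_def poly_prod)
  also have "\<dots> = ((- 1) ^ N * (- 1) ^ N) * (\<Prod>l<N. (1 - fps_X ^ (1 + 3 * l)) * (1 - fps_X ^ (2 + 3 * l)))"
    unfolding prod.distrib prod_constant card_lessThan by (simp only: mult_ac)
  finally have S: "S = (\<Prod>l<N. (1 - fps_X ^ (1 + 3 * l)) * (1 - fps_X ^ (2 + 3 * l)))"
    by (simp flip: power_add mult_2)
  have "euler_prod 1 (3 * M) = euler_prod 3 M * (\<Prod>l<M. (1 - fps_X ^ (1 + 3 * l)) * (1 - fps_X ^ (2 + 3 * l)))" for M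
  proof (induction M)
    case (Suc M)
    have "3 * Suc M = Suc (Suc (Suc (3 * M)))" by simp
    then show ?case
      unfolding \<open>3 * Suc M = _\<close> euler_prod_Suc Suc prod.lessThan_Suc by (simp add: mult_ac)
  qed simp
  then have E: "euler_prod 1 (3 * N) = euler_prod 3 N * S" by (simp add: S)
  have "fps_eq_upto K (euler_fps 1) (euler_prod 1 (3 * N))"
    by (rule fps_eq_upto_sym, rule euler_prod_eq_upto) (simp_all add: N_def)
  also have "fps_eq_upto K (euler_prod 1 (3 * N)) (euler_fps 3 * S)"
    unfolding E by (intro fps_eq_upto_mult euler_prod_eq_upto) (simp_all add: N_def)
  also have "fps_eq_upto K (euler_fps 3 * S) (qsum alt (theta_exp 2 1))"
    unfolding S_def by (rule jacobi_sum_eq_upto) (simp_all add: N_def)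
  finally show "fps_eq_upto K (euler_fps 1) (qsum alt (theta_exp 2 1))" .
qed

text \<open>The triple product for (1, 0) contains the factor z + 1. It therefore vanishes at z =
  -1, and its derivative there is the value of the cofactor.\<close>

lemma jacobi_cube: "euler_fps 1 ^ 3 = qsum (\<lambda>n. alt n * of_int n) tri"
proof (rule fps_eqI_upto)
  fix K :: nat
  define M where "M = Suc (2 * K)"
  define N where "N = Suc M"
  define J where "J = jacobi_poly 1 0 N N"
  \<comment> \<open>The cofactor of z + 1: once that factor is taken out, \<open>M = N - 1\<close>
    factors of the second kind remain, with exponents starting at 1.\<close>
  define H where "H = (\<Prod>l<N. [:1, fps_X ^ Suc l:]) * (\<Prod>l<M. [:fps_X ^ Suc l, 1 :: rat fps:])"
  define S where "S = (\<Sum>k\<le>2 * N. fps_const (alt (int k - int N) * of_int (int k - int N)) * coeff J k)"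
  have J: "J = [:1, 1:] * H"
  proof -
    have "(\<Prod>l<N. [:fps_X ^ (0 + (1 + 0) * l), 1 :: rat fps:]) = [:1, 1:] * (\<Prod>l<M. [:fps_X ^ Suc l, 1:])"
      by (simp add: N_def prod.lessThan_Suc_shift del: prod.lessThan_Suc mult_pCons_left)
    then show ?thesis
      unfolding J_def H_def jacobi_poly_def by (simp add: mult.left_commute del: mult_pCons_left)
  qed
  have H: "poly H (- 1) = euler_prod 1 N * ((- 1) ^ M * euler_prod 1 M)"
  proof -
    have "poly H (- 1) = (\<Prod>l<N. 1 - fps_X ^ Suc l) * (\<Prod>l<M. - 1 * (1 - fps_X ^ Suc l))"
      by (simp add: H_def poly_prod)
    also have "\<dots> = euler_prod 1 N * ((- 1) ^ M * euler_prod 1 M)"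
      unfolding prod.distrib prod_constant card_lessThan by (simp add: euler_prod_def)
    finally show ?thesis .
  qed
  have 0: "(\<Sum>k\<le>2 * N. coeff J k * (- 1) ^ k) = 0"
    using poly_jacobi_poly[of 1 0 N N "- 1"] J unfolding J_def[symmetric] by (simp add: mult_2)
  have "poly (pderiv J) (- 1) = poly H (- 1)"
    unfolding J pderiv_mult by (simp add: pderiv_pCons)
  then have "poly H (- 1) = (\<Sum>k\<le>2 * N. of_nat k * coeff J k * (- 1) ^ (k - 1))"
    using poly_pderiv_jacobi_poly[of 1 0 N N "- 1"] unfolding J_def[symmetric] by (simp add: mult_2)
  also have "\<dots> = (\<Sum>k\<le>2 * N. - (of_nat k * (coeff J k * (- 1) ^ k)))"
  proof (rule sum.cong)
    fix k show "of_nat k * coeff J k * (- 1) ^ (k - 1) = - (of_nat k * (coeff J k * (- 1) ^ k))"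
      by (cases k) simp_all
  qed simp
  finally have 1: "(\<Sum>k\<le>2 * N. of_nat k * (coeff J k * (- 1) ^ k)) = - poly H (- 1)"
    by (simp add: sum_negf)
  have c: "fps_const (rat_of_int (int k - int N)) = of_nat k - of_nat N" for k
    by (simp flip: fps_of_nat)
  have "S = (- 1) ^ N * (\<Sum>k\<le>2 * N. (of_nat k - of_nat N) * (coeff J k * (- 1) ^ k))"
    unfolding S_def fps_const_mult[symmetric] fps_const_alt c sum_distrib_left by (simp only: mult_ac)
  \<comment> \<open>Shifting the weight from k to k - N changes nothing because \<open>J\<close>
    vanishes at -1.\<close>
  also have "(\<Sum>k\<le>2 * N. (of_nat k - of_nat N) * (coeff J k * (- 1) ^ k)) = - poly H (- 1)"
    unfolding left_diff_distrib sum_subtractf 1 sum_distrib_left[symmetric] 0 by simp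
  also have "(- 1) ^ N * - poly H (- 1) = ((- 1) ^ M * (- 1) ^ M) * (euler_prod 1 N * euler_prod 1 M)"
    unfolding H N_def power_Suc by simp
  finally have S: "S = euler_prod 1 N * euler_prod 1 M"
    by (simp flip: power_add mult_2)
  have "fps_eq_upto K (euler_fps 1 * (euler_fps 1 * euler_fps 1)) (euler_fps 1 * S)"
    unfolding S
    by (rule fps_eq_upto_sym, intro fps_eq_upto_mult[OF fps_eq_upto_refl] fps_eq_upto_mult euler_prod_eq_upto)
      (simp_all add: N_def M_def)
  also have "fps_eq_upto K (euler_fps 1 * S) (qsum (\<lambda>n. alt n * of_int n) (theta_exp 1 0))"
    unfolding S_def J_def by (rule jacobi_sum_eq_upto) (simp_all add: N_def M_def)
  also have "theta_exp 1 0 = tri" by (auto simp: theta_exp_def)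
  finally show "fps_eq_upto K (euler_fps 1 ^ 3) (qsum (\<lambda>n. alt n * of_int n) tri)"
    by (simp add: power3_eq_cube mult.assoc)
qed

section \<open>The theta series for 3-cores\<close>

text \<open>The value is 3(m^2 + mn + n^2) + 2m + n. There is one theta exponent for each factor of
  the dissection modulo 3, and the indices add up to 0 because the coefficient of z^0 is
  taken.\<close>

fun three_core_exp :: "int \<times> int \<Rightarrow> nat" where
  "three_core_exp (m, n) = theta_exp 3 0 m + (theta_exp 2 1 n + theta_exp 1 2 (- m - n))"

text \<open>The exponents are sorted modulo 3. The classes 0, 1, 2 on the side of 1 + zX^k go to (3,
  0), (1, 2), (2, 1); on the side of z + X^k they go to (3, 0), (2, 1), (1, 2).\<close>

lemma jacobi_poly_three_dissection:
  "jacobi_poly 1 0 (3 * N) (3 * N) = jacobi_poly 3 0 N N * (jacobi_poly 2 1 N N * jacobi_poly 1 2 N N)"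
proof -
  have *: "(\<Prod>l<3 * M. f l) = (\<Prod>l<M. f (3 * l)) * ((\<Prod>l<M. f (3 * l + 1)) * (\<Prod>l<M. f (3 * l + 2)))"
    for f :: "nat \<Rightarrow> rat fps poly" and M
  proof (induction M)
    case (Suc M)
    have "3 * Suc M = Suc (Suc (Suc (3 * M)))" by simp
    then show ?case unfolding \<open>3 * Suc M = _\<close> prod.lessThan_Suc Suc by (simp add: mult_ac)
  qed simp
  have e: "1 + (1 + 0) * (3 * l) = 1 + (1 + 2) * l" "1 + (1 + 0) * (3 * l + 1) = 2 + (2 + 1) * l"
    "1 + (1 + 0) * (3 * l + 2) = 3 + (3 + 0) * l" "0 + (1 + 0) * (3 * l) = 0 + (3 + 0) * l"
    "0 + (1 + 0) * (3 * l + 1) = 1 + (2 + 1) * l" "0 + (1 + 0) * (3 * l + 2) = 2 + (1 + 2) * l" for l :: nat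
    by simp_all
  show ?thesis
    unfolding jacobi_poly_def * e by (simp only: mult_ac)
qed

lemma coeff_mult_mult:
  fixes p q r :: "'a :: comm_semiring_1 poly"
  shows "coeff (p * (q * r)) n =
    (\<Sum>(i, j) | i + j \<le> n. coeff p i * (coeff q j * coeff r (n - i - j)))"
proof -
  have "coeff (p * (q * r)) n = (\<Sum>i\<le>n. \<Sum>j\<le>n - i. coeff p i * (coeff q j * coeff r (n - i - j)))"
    by (simp add: coeff_mult sum_distrib_left)
  also have "\<dots> = (\<Sum>(i, j)\<in>(SIGMA i:{..n}. {..n - i}). coeff p i * (coeff q j * coeff r (n - i - j)))"
    by (subst sum.Sigma) auto
  also have "(SIGMA i:{..n}. {..n - i}) = {(i, j). i + j \<le> n}" by auto
  finally show ?thesis .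
qed

text \<open>Central coefficients of the dissection are compared. On the left stands a Gaussian
  binomial with limit 1 / \<open>euler_fps 1\<close>; on the right, each of the three coefficients
  in a term tends to a power of X after multiplication by \<open>euler_fps 3\<close>.\<close>

lemma three_core_series:
  "euler_fps 3 ^ 3 = euler_fps 1 * qsum (\<lambda>_. 1) three_core_exp"
proof (rule fps_eqI_upto)
  fix K :: nat
  define N where "N = 2 * K"
  define A where "A = jacobi_poly 3 0 N N"
  define B where "B = jacobi_poly 2 1 N N"
  define C where "C = jacobi_poly 1 2 N N"
  define G where "G = gauss_binomial 1 (6 * N) (3 * N)"
  let ?e = "euler_fps 3"
  \<comment> \<open>The pairs for which none of the indices i, j and 3N - i - j exceeds the degree
    bound 2N.\<close>
  define F where "F = {(i, j). i + j \<le> 3 * N \<and> i \<le> 2 * N \<and> j \<le> 2 * N \<and> N \<le> i + j}"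
  define sh where "sh = (\<lambda>(i, j). (int i - int N, int j - int N))"
  have fin: "finite {(i, j). i + j \<le> 3 * N}"
    by (rule finite_subset[of _ "{..3 * N} \<times> {..3 * N}"]) auto
  have finF: "finite F" by (rule finite_subset[OF _ fin]) (auto simp: F_def)
  have G: "G = (\<Sum>(i, j) | i + j \<le> 3 * N. coeff A i * (coeff B j * coeff C (3 * N - i - j)))"
  proof -
    have "G = coeff (jacobi_poly 1 0 (3 * N) (3 * N)) (3 * N)"
      by (subst coeff_jacobi_poly[of 1]) (simp_all add: G_def)
    then show ?thesis unfolding jacobi_poly_three_dissection A_def B_def C_def coeff_mult_mult .
  qed
  also have "\<dots> = (\<Sum>(i, j)\<in>F. coeff A i * (coeff B j * coeff C (3 * N - i - j)))"
  proof (rule sum.mono_neutral_right[OF fin])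
    show "F \<subseteq> {(i, j). i + j \<le> 3 * N}" by (auto simp: F_def)
    show "\<forall>x\<in>{(i, j). i + j \<le> 3 * N} - F. (case x of (i, j) \<Rightarrow> coeff A i * (coeff B j * coeff C (3 * N - i - j))) = 0"
    proof (intro ballI)
      fix x assume x: "x \<in> {(i, j). i + j \<le> 3 * N} - F"
      obtain i j where ij: "x = (i, j)" by fastforce
      with x consider "2 * N < i" | "2 * N < j" | "2 * N < 3 * N - i - j"
        unfolding F_def by fastforce
      then have "coeff A i = 0 \<or> coeff B j = 0 \<or> coeff C (3 * N - i - j) = 0"
        using degree_jacobi_poly[of 3 0 N N] degree_jacobi_poly[of 2 1 N N] degree_jacobi_poly[of 1 2 N N]
        by cases (simp_all add: A_def B_def C_def coeff_eq_0)
      then show "(case x of (i, j) \<Rightarrow> coeff A i * (coeff B j * coeff C (3 * N - i - j))) = 0"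
        by (auto simp: ij)
    qed
  qed
  finally have G: "G = (\<Sum>(i, j)\<in>F. coeff A i * (coeff B j * coeff C (3 * N - i - j)))" .
  have trm: "fps_eq_upto K (?e * coeff A i * (?e * coeff B j * (?e * coeff C (3 * N - i - j))))
      (fps_X ^ three_core_exp (sh (i, j)))" if "(i, j) \<in> F" for i j
  proof -
    have ij: "i \<le> 2 * N" "j \<le> 2 * N" "3 * N - i - j \<le> 2 * N"
      and k: "int (3 * N - i - j) - int N = - (int i - int N) - (int j - int N)"
      using that by (auto simp: F_def)
    have "fps_eq_upto K (?e * coeff (jacobi_poly \<alpha> \<beta> N N) k) (fps_X ^ theta_exp \<alpha> \<beta> (int k - int N))"
      if "3 = \<alpha> + \<beta>" "k \<le> 2 * N" for \<alpha> \<beta> k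
      unfolding coeff_jacobi_poly[OF that(1) zero_less_numeral] mult_2[symmetric]
      by (rule gauss_binomial_theta_eq_upto) (use that in \<open>simp_all add: N_def\<close>)
    from this[of 3 0, OF _ ij(1)] this[of 2 1, OF _ ij(2)] this[of 1 2, OF _ ij(3)]
    have "fps_eq_upto K (?e * coeff A i) (fps_X ^ theta_exp 3 0 (int i - int N))"
      "fps_eq_upto K (?e * coeff B j) (fps_X ^ theta_exp 2 1 (int j - int N))"
      "fps_eq_upto K (?e * coeff C (3 * N - i - j)) (fps_X ^ theta_exp 1 2 (- (int i - int N) - (int j - int N)))"
      unfolding A_def B_def C_def k by simp_all
    then show ?thesis
      unfolding sh_def three_core_exp.simps prod.case power_add by (intro fps_eq_upto_mult)
  qed
  have "fps_eq_upto K (\<Sum>(i, j)\<in>F. ?e * coeff A i * (?e * coeff B j * (?e * coeff C (3 * N - i - j))))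
      (\<Sum>x\<in>F. fps_X ^ three_core_exp (sh x))"
    using trm by (intro fps_eq_upto_sum) auto
  also have "(\<Sum>(i, j)\<in>F. ?e * coeff A i * (?e * coeff B j * (?e * coeff C (3 * N - i - j)))) = ?e ^ 3 * G"
    unfolding G sum_distrib_left by (intro sum.cong) (auto simp: power3_eq_cube mult_ac)
  also have "(\<Sum>x\<in>F. fps_X ^ three_core_exp (sh x)) = (\<Sum>x\<in>sh ` F. fps_const 1 * fps_X ^ three_core_exp x)"
    by (subst sum.reindex) (auto simp: inj_on_def sh_def)
  also have "fps_eq_upto K \<dots> (qsum (\<lambda>_. 1) three_core_exp)"
  proof (rule fps_eq_upto_sym, rule qsum_eq_upto)
    fix x assume x: "three_core_exp x < K"
    obtain m n where mn: "x = (m, n)" by fastforce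
    have "\<bar>m\<bar> \<le> int K" "\<bar>n\<bar> \<le> int K" "\<bar>- m - n\<bar> \<le> int K"
      using x abs_le_theta_exp[of 3 0 m] abs_le_theta_exp[of 2 1 n] abs_le_theta_exp[of 1 2 "- m - n"]
      by (simp_all add: mn)
    then have "(nat (m + int N), nat (n + int N)) \<in> F" "x = sh (nat (m + int N), nat (n + int N))"
      by (auto simp: F_def N_def mn sh_def)
    then show "x \<in> sh ` F" by blast
  qed (simp add: finF)
  finally have "fps_eq_upto K (euler_fps 1 * (?e ^ 3 * G)) (euler_fps 1 * qsum (\<lambda>_. 1) three_core_exp)"
    by (intro fps_eq_upto_mult[OF fps_eq_upto_refl])
  moreover have "fps_eq_upto K (?e ^ 3 * (euler_fps 1 * G)) (?e ^ 3 * 1)"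
    unfolding G_def by (intro fps_eq_upto_mult[OF fps_eq_upto_refl] gauss_binomial_eq_upto) (simp_all add: N_def)
  ultimately show "fps_eq_upto K (?e ^ 3) (euler_fps 1 * qsum (\<lambda>_. 1) three_core_exp)"
    by (metis (no_types, lifting) fps_eq_upto_sym fps_eq_upto_trans mult.left_commute mult_1_right)
qed

section \<open>The eighth power of the Euler product\<close>

lemma finite_tri: "finite {n. tri n \<le> k}"
  using finite_theta_exp[of 1 0 k] by (simp add: theta_exp_def)

fun tri3 :: "int \<times> int \<times> int \<Rightarrow> nat" where
  "tri3 (i, j, k) = tri i + (tri j + tri k)"

fun alt3 :: "int \<times> int \<times> int \<Rightarrow> rat" where
  "alt3 (i, j, k) = alt i * (alt j * alt k)"

lemma finite_tri3: "finite {x. tri3 x = k}"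
proof (rule finite_subset)
  show "{x. tri3 x = k} \<subseteq> {n. tri n \<le> k} \<times> {n. tri n \<le> k} \<times> {n. tri n \<le> k}" by auto
qed (intro finite_cartesian_product finite_tri)

text \<open>The reflection n -> -1 - n of the variable absent from the weight preserves
  \<open>tri\<close> and reverses the sign.\<close>

lemma qsum_missing_variable:
  "qsum (\<lambda>(i, j, k). alt3 (i, j, k) * f i j) tri3 = 0"
  "qsum (\<lambda>(i, j, k). alt3 (i, j, k) * f j k) tri3 = 0"
  "qsum (\<lambda>(i, j, k). alt3 (i, j, k) * f k i) tri3 = 0"
proof -
  have alt: "alt (- 1 - n) = - alt n" for n by (simp add: alt_diff)
  show "qsum (\<lambda>(i, j, k). alt3 (i, j, k) * f i j) tri3 = 0"
    by (rule qsum_eq_0_involution[of "\<lambda>(i, j, k). (i, j, - 1 - k)"])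
      (auto simp: alt tri_neg intro!: involuntory_imp_bij)
  show "qsum (\<lambda>(i, j, k). alt3 (i, j, k) * f j k) tri3 = 0"
    by (rule qsum_eq_0_involution[of "\<lambda>(i, j, k). (- 1 - i, j, k)"])
      (auto simp: alt tri_neg intro!: involuntory_imp_bij)
  show "qsum (\<lambda>(i, j, k). alt3 (i, j, k) * f k i) tri3 = 0"
    by (rule qsum_eq_0_involution[of "\<lambda>(i, j, k). (i, - 1 - j, k)"])
      (auto simp: alt tri_neg intro!: involuntory_imp_bij)
qed

text \<open>The harmonic cubic \<open>(2i - j - k)(2j - i - k)(2k - i - j)\<close> equals \<open>12ijk\<close> up to monomials that
  miss a variable; these contribute nothing because \<open>\<Sum>\<^sub>n (-1)\<^sup>n X\<^bsup>n(n+1)/2\<^esup> = 0\<close>.\<close>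
lemma euler_fps_power_9:
  "fps_const 12 * euler_fps 1 ^ 9 = qsum (\<lambda>(i, j, k).
     alt3 (i, j, k) * of_int ((2 * i - j - k) * (2 * j - i - k) * (2 * k - i - j))) tri3"
proof -
  define c where "c n = alt n * rat_of_int n" for n
  define u where "u i j = rat_of_int (2 * i ^ 3 - 3 * i ^ 2 * j - 3 * i * j ^ 2)" for i j
  have s: "qsummable c tri"
    unfolding qsummable_def by (auto intro: finite_subset[OF _ finite_tri])
  have "euler_fps 1 ^ 9 = qsum c tri * (qsum c tri * qsum c tri)"
  proof -
    have "euler_fps 1 ^ 9 = (euler_fps 1 ^ 3) ^ 3" by (simp flip: power_mult)
    then show ?thesis unfolding jacobi_cube c_def by (simp only: power3_eq_cube mult.assoc)
  qed
  also have "\<dots> = qsum (\<lambda>(i, j, k). c i * (c j * c k)) tri3"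
    unfolding qsum_mult[OF s s] qsum_mult[OF s qsummable_mult[OF s s]]
    by (intro arg_cong2[where f = qsum]) (auto simp: fun_eq_iff)
  finally have "fps_const 12 * euler_fps 1 ^ 9 = qsum (\<lambda>x. 12 * (case x of (i, j, k) \<Rightarrow> c i * (c j * c k))) tri3"
    by (simp only: qsum_scale)
  also have "\<dots> = qsum (\<lambda>x. 12 * (case x of (i, j, k) \<Rightarrow> c i * (c j * c k)) +
    ((case x of (i, j, k) \<Rightarrow> alt3 (i, j, k) * u i j) + ((case x of (i, j, k) \<Rightarrow> alt3 (i, j, k) * u j k) +
     (case x of (i, j, k) \<Rightarrow> alt3 (i, j, k) * u k i)))) tri3"
    unfolding qsum_add[OF finite_tri3] qsum_missing_variable by simp
  also have "\<dots> = qsum (\<lambda>(i, j, k).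
     alt3 (i, j, k) * of_int ((2 * i - j - k) * (2 * j - i - k) * (2 * k - i - j))) tri3"
  proof (intro arg_cong2[where f = qsum] refl ext, clarify)
    fix i j k :: int
    have "(2 * i - j - k) * (2 * j - i - k) * (2 * k - i - j) = 12 * (i * j * k) +
      ((2 * i ^ 3 - 3 * i ^ 2 * j - 3 * i * j ^ 2) + ((2 * j ^ 3 - 3 * j ^ 2 * k - 3 * j * k ^ 2) +
       (2 * k ^ 3 - 3 * k ^ 2 * i - 3 * k * i ^ 2)))"
      by (simp add: algebra_simps power2_eq_square power3_eq_cube)
    then have "rat_of_int ((2 * i - j - k) * (2 * j - i - k) * (2 * k - i - j)) =
        12 * (of_int i * of_int j * of_int k) + (u i j + (u j k + u k i))"
      unfolding u_def by (simp only: of_int_add of_int_mult of_int_numeral)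
    then show "12 * (c i * (c j * c k)) + (alt3 (i, j, k) * u i j + (alt3 (i, j, k) * u j k + alt3 (i, j, k) * u k i)) =
      alt3 (i, j, k) * of_int ((2 * i - j - k) * (2 * j - i - k) * (2 * k - i - j))"
      by (simp add: c_def distrib_left mult_ac)
  qed
  finally show ?thesis .
qed

section \<open>Summation along the diagonal\<close>

definition trace_part :: "int \<Rightarrow> int \<times> int \<Rightarrow> rat" where
  "trace_part r z = (if (fst z + snd z) mod 3 = r then of_int (trace_cube z) else 0)"

text \<open>The terms of \<open>euler_fps_power_9\<close> in the coordinates a = i - k, b = j - k,
  in which the cubic becomes \<open>trace_cube (a, b)\<close>, restricted to one class of a + b
  modulo 3.\<close>

definition sliced :: "int \<Rightarrow> int \<times> int \<times> int \<Rightarrow> rat" where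
  "sliced r = (\<lambda>(a, b, k). alt (a + b) * alt k * trace_part r (a, b))"

fun shear :: "int \<times> int \<times> int \<Rightarrow> int \<times> int \<times> int" where
  "shear (a, b, k) = (a + k, b + k, k)"

lemma bij_shear: "bij shear"
proof (rule o_bij)
  show "(\<lambda>(i, j, k). (i - k, j - k, k)) \<circ> shear = id" "shear \<circ> (\<lambda>(i, j, k). (i - k, j - k, k)) = id"
    by auto
qed

lemma two_tri3_shear:
  "2 * int (tri3 (shear (a, b, k))) = 3 * k * (k + 1) + 2 * k * (a + b) + a * (a + 1) + b * (b + 1)"
proof -
  have "2 * int (tri3 (shear (a, b, k))) = (2 * int (tri (a + k))) + (2 * int (tri (b + k)) + 2 * int (tri k))"
    by simp
  then show ?thesis unfolding two_tri by (simp add: algebra_simps)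
qed

text \<open>If a + b is prime to 3, the norm is 1 modulo 3, and this is the n with norm 3n +
  1.\<close>

definition norm_exp :: "int \<times> int \<Rightarrow> nat" where
  "norm_exp z = nat (enorm z div 3)"

lemma enorm_mod_3:
  assumes "enorm (a, b) = n"
  shows "n mod 3 = ((a + b) * (a + b)) mod 3"
proof -
  have "n = (a + b) * (a + b) + 3 * (- a * b)"
    using assms by (simp add: algebra_simps power2_eq_square)
  then show ?thesis by (metis mod_mult_self2)
qed

lemma enorm_nonneg: "enorm z \<ge> 0"
proof (cases z)
  case (Pair a b)
  have "4 * enorm (a, b) \<ge> 0" unfolding four_enorm(1) by simp
  then show ?thesis by (simp add: Pair)
qed

lemma norm_exp_eq_iff:
  assumes "(a + b) mod 3 = 1"
  shows "norm_exp (a, b) = n \<longleftrightarrow> enorm (a, b) = 3 * int n + 1"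
proof -
  have "((a + b) * (a + b)) mod 3 = 1"
    using assms mod_mult_eq[of "a + b" 3 "a + b"] by simp
  then have "enorm (a, b) mod 3 = 1" using enorm_mod_3[OF refl, of a b] by simp
  then have e: "enorm (a, b) = 3 * (enorm (a, b) div 3) + 1" by presburger
  moreover have "enorm (a, b) div 3 \<ge> 0" using enorm_nonneg by (simp add: pos_imp_zdiv_nonneg_iff del: enorm.simps)
  ultimately show ?thesis unfolding norm_exp_def by linarith
qed

text \<open>Macdonald's identity for the root system of type A2. For fixed (a, b) the sum over k
  vanishes if 3 divides a + b, and otherwise is a pentagonal number series up to sign and a power of
  X. The classes 1 and 2 contribute equally, and one Euler product is cancelled.\<close>

lemma macdonald_A2:
  "fps_const 6 * euler_fps 1 ^ 8 = qsum (trace_part 1) norm_exp"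
proof -
  let ?g = "\<lambda>x. tri3 (shear x)"
  have fin: "finite {x. ?g x = k}" for k
  proof -
    have "{x. ?g x = k} = shear -` {x. tri3 x = k}" by auto
    then show ?thesis using finite_vimageI[OF finite_tri3 bij_is_inj[OF bij_shear]] by simp
  qed
  have "fps_const 12 * euler_fps 1 ^ 9 = qsum (\<lambda>x. sliced 0 x + (sliced 1 x + sliced 2 x)) ?g"
    unfolding euler_fps_power_9
  proof (rule qsum_reindex[OF bij_shear, symmetric])
    fix x :: "int \<times> int \<times> int"
    obtain a b k where x: "x = (a, b, k)" by (metis prod_cases3)
    have "(a + b) mod 3 \<in> {0, 1, 2}" 
      using pos_mod_bound[of 3 "a + b"] pos_mod_sign[of 3 "a + b"] by auto
    then have "sliced 0 x + (sliced 1 x + sliced 2 x) = alt (a + b) * alt k * of_int (trace_cube (a, b))"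
      by (auto simp: sliced_def trace_part_def x simp del: trace_cube.simps)
    moreover have "alt3 (shear x) = alt (a + b) * alt k"
      by (simp add: x alt_add)
    moreover have "(2 * (a + k) - (b + k) - k) * (2 * (b + k) - (a + k) - k) * (2 * k - (a + k) - (b + k)) =
       trace_cube (a, b)" by (simp add: algebra_simps)
    ultimately show "(case shear x of (i, j, k) \<Rightarrow> alt3 (i, j, k) *
          of_int ((2 * i - j - k) * (2 * j - i - k) * (2 * k - i - j))) =
       sliced 0 x + (sliced 1 x + sliced 2 x)"
      unfolding x shear.simps prod.case by (simp only:)
  qed simp
  also have "\<dots> = qsum (sliced 0) ?g + (qsum (sliced 1) ?g + qsum (sliced 2) ?g)"
    by (simp only: qsum_add[OF fin])
  also have "qsum (sliced 0) ?g = 0"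
  \<comment> \<open>For a + b = 3q the exponent is a quadratic polynomial in k that is symmetric
    under k -> -1 - 2q - k, and this reflection changes the parity of k.\<close>
  proof (rule qsum_eq_0_involution[of "\<lambda>(a, b, k). (a, b, - 1 - 2 * ((a + b) div 3) - k)"])
    show "bij (\<lambda>(a, b, k). (a, b, - 1 - 2 * ((a + b) div 3) - k :: int))"
      by (rule involuntory_imp_bij) auto
    show "sliced 0 (case x of (a, b, k) \<Rightarrow> (a, b, - 1 - 2 * ((a + b) div 3) - k)) = - sliced 0 x" for x
      by (cases x) (auto simp: sliced_def alt_def)
    fix x assume "sliced 0 x \<noteq> 0"
    then obtain a b k where x: "x = (a, b, k)" "(a + b) mod 3 = 0"
      by (cases x) (auto simp: sliced_def trace_part_def split: if_splits)
    then obtain q where q: "a + b = 3 * q" by auto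
    have "2 * int (?g (a, b, - 1 - 2 * q - k)) = 2 * int (?g (a, b, k))"
      unfolding two_tri3_shear q by (simp add: algebra_simps)
    then show "?g (case x of (a, b, k) \<Rightarrow> (a, b, - 1 - 2 * ((a + b) div 3) - k)) = ?g x"
      unfolding x prod.case q by simp
  qed
  also have "qsum (sliced 2) ?g = qsum (sliced 1) ?g"
  \<comment> \<open>Negation exchanges the classes 1 and 2; the sign of the cubic cancels against
    that of k -> -1 - k.\<close>
  proof (rule qsum_reindex[of "\<lambda>(a, b, k). (- a, - b, - 1 - k)"])
    show "bij (\<lambda>(a, b, k). (- a, - b, - 1 - k :: int) :: int \<times> int \<times> int)"
      by (rule involuntory_imp_bij) auto
    fix x :: "int \<times> int \<times> int"
    obtain a b k where x: "x = (a, b, k)" by (metis prod_cases3)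
    have m: "(- a - b) mod 3 = 1 \<longleftrightarrow> (a + b) mod 3 = 2" by presburger
    have t: "trace_cube (- a, - b) = - trace_cube (a, b)" by (simp add: algebra_simps)
    have "trace_part 1 (- a, - b) = - trace_part 2 (a, b)"
      by (simp add: trace_part_def m t del: trace_cube.simps)
    then show "sliced 1 (case x of (a, b, k) \<Rightarrow> (- a, - b, - 1 - k)) = sliced 2 x"
      by (simp add: x sliced_def alt_add alt_diff)
    have "2 * int (?g (- a, - b, - 1 - k)) = 2 * int (?g (a, b, k))"
      unfolding two_tri3_shear by (simp add: algebra_simps)
    then show "?g (case x of (a, b, k) \<Rightarrow> (- a, - b, - 1 - k)) = ?g x" by (simp add: x del: tri3.simps shear.simps)
  qed
  also have "qsum (sliced 1) ?g = 
    qsum (\<lambda>(z, n). trace_part 1 z * alt n) (\<lambda>(z, n). norm_exp z + theta_exp 2 1 n)"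
  \<comment> \<open>For a + b = 3q + 1 and n = -k - 1 - q the exponent separates into (N(a, b) -
    1)/3 and the pentagonal number of n.\<close>
  proof (rule qsum_reindex[of "\<lambda>(a, b, k). ((a, b), - k - 1 - (a + b) div 3)"])
    show "bij (\<lambda>(a, b, k). ((a, b), - k - 1 - (a + b) div 3 :: int))"
    proof (rule o_bij)
      show "(\<lambda>((a, b), n). (a, b, - n - 1 - (a + b) div 3 :: int)) \<circ> (\<lambda>(a, b, k). ((a, b), - k - 1 - (a + b) div 3 :: int)) = id"
        "(\<lambda>(a, b, k). ((a, b), - k - 1 - (a + b) div 3 :: int)) \<circ> (\<lambda>((a, b), n). (a, b, - n - 1 - (a + b) div 3 :: int)) = id"
        by auto
    qed
    fix x :: "int \<times> int \<times> int"
    obtain a b k where x: "x = (a, b, k)" by (metis prod_cases3)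
    define q where "q = (a + b) div 3"
    show "(case case x of (a, b, k) \<Rightarrow> ((a, b), - k - 1 - (a + b) div 3) of (z, n) \<Rightarrow> trace_part 1 z * alt n) =
        sliced 1 x"
    proof (cases "(a + b) mod 3 = 1")
      case True
      then have "a + b = 3 * q + 1" unfolding q_def by presburger
      then have "alt (- k - 1 - q) = alt (a + b) * alt k"
        by (simp add: alt_add alt_diff) (simp add: alt_def)
      then show ?thesis by (simp add: x sliced_def q_def)
    qed (simp add: x sliced_def trace_part_def)
    assume "sliced 1 x \<noteq> 0"
    then have m: "(a + b) mod 3 = 1"
      by (auto simp: x sliced_def trace_part_def split: if_splits)
    then have q: "a = 3 * q + 1 - b" unfolding q_def by presburger
    have "3 * (2 * int (?g (a, b, k))) = 
      2 * (enorm (a, b) - 1) + 3 * (2 * int (theta_exp 2 1 (- k - 1 - q)))"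
      unfolding two_tri3_shear two_theta_exp by (simp add: q algebra_simps power2_eq_square)
    moreover have "enorm (a, b) = 3 * int (norm_exp (a, b)) + 1"
      using norm_exp_eq_iff[OF m] by blast
    ultimately have "int (?g (a, b, k)) = int (norm_exp (a, b) + theta_exp 2 1 (- k - 1 - q))" by simp
    then show "(case case x of (a, b, k) \<Rightarrow> ((a, b), - k - 1 - (a + b) div 3) of
        (z, n) \<Rightarrow> norm_exp z + theta_exp 2 1 n) = ?g x"
      unfolding x prod.case q_def[symmetric] by linarith
  qed
  also have "\<dots> = qsum (trace_part 1) norm_exp * euler_fps 1"
  proof -
    have "finite {z. trace_part 1 z \<noteq> 0 \<and> norm_exp z = k}" for k
    proof (rule finite_subset)
      show "{z. trace_part 1 z \<noteq> 0 \<and> norm_exp z = k} \<subseteq> {z. enorm z = 3 * int k + 1}"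
      proof clarify
        fix a b assume "trace_part 1 (a, b) \<noteq> 0"
        then have "(a + b) mod 3 = 1" by (simp add: trace_part_def split: if_splits)
        from norm_exp_eq_iff[OF this] show "enorm (a, b) = 3 * int (norm_exp (a, b)) + 1" by blast
      qed
    qed (rule finite_enorm_eq)
    then have "qsummable (trace_part 1) norm_exp" by (simp add: qsummable_def)
    moreover have "qsummable alt (theta_exp 2 1)"
      unfolding qsummable_def by (auto intro: finite_subset[OF _ finite_theta_exp[of 2 1]])
    ultimately show ?thesis unfolding euler_pentagonal by (simp add: qsum_mult)
  qed
  finally have 12: "fps_const 12 * euler_fps 1 ^ 9 = fps_const 2 * qsum (trace_part 1) norm_exp * euler_fps 1"
    by (simp add: numeral_fps_const[symmetric] algebra_simps)
  have "fps_const (12 :: rat) = fps_const 2 * fps_const 6" by (simp only: fps_const_mult) simp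
  moreover have "euler_fps 1 ^ 9 = euler_fps 1 ^ 8 * euler_fps 1"
    by (simp add: eval_nat_numeral)
  ultimately have "fps_const 2 * (fps_const 6 * euler_fps 1 ^ 8) * euler_fps 1 = fps_const 12 * euler_fps 1 ^ 9"
    by (simp only: mult.assoc)
  then have "fps_const 2 * (fps_const 6 * euler_fps 1 ^ 8) * euler_fps 1 =
      fps_const 2 * qsum (trace_part 1) norm_exp * euler_fps 1"
    unfolding 12 .
  moreover have "euler_fps 1 \<noteq> 0" using euler_fps_nth_0[of 1] by auto
  moreover have "fps_const (2 :: rat) \<noteq> 0" by simp
  ultimately show ?thesis by (metis mult_left_cancel mult_right_cancel)
qed

text \<open>The norm is (a + b)^2 modulo 3, so a + b lies in the class 1 or 2. The map z -> -z
  exchanges these classes and preserves \<open>hecke\<close>, and the character is 1 on the class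
  1.\<close>

lemma hecke_sum_eq_trace_sum:
  "hecke_sum (3 * n + 1) = 2 * (\<Sum>z | (fst z + snd z) mod 3 = 1 \<and> enorm z = int (3 * n + 1). trace_cube z)"
proof -
  let ?S = "\<lambda>r. {z. (fst z + snd z) mod 3 = r \<and> enorm z = int (3 * n + 1)}"
  have fin: "finite (?S r)" for r
    by (rule finite_subset[OF _ finite_enorm_eq]) auto
  have disjoint: "?S 1 \<inter> ?S 2 = {}" by auto
  have union: "{z. enorm z = int (3 * n + 1)} = ?S 1 \<union> ?S 2"
  proof (intro subset_antisym subsetI)
    fix z assume z: "z \<in> {z. enorm z = int (3 * n + 1)}"
    obtain a b where ab: "z = (a, b)" by fastforce
    have "((a + b) * (a + b)) mod 3 = 1" using enorm_mod_3[of a b] z ab by simp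
    then have "(a + b) mod 3 \<noteq> 0" by auto
    then have "(a + b) mod 3 = 1 \<or> (a + b) mod 3 = 2" by presburger
    then show "z \<in> ?S 1 \<union> ?S 2" using z ab by simp
  qed auto
  have "hecke_sum (3 * n + 1) = sum hecke (?S 1) + sum hecke (?S 2)"
    unfolding hecke_sum_def union by (rule sum.union_disjoint[OF fin fin disjoint])
  also have "sum hecke (?S 2) = sum hecke (?S 1)"
  proof (rule sum.reindex_bij_witness[of _ "\<lambda>(a, b). (- a, - b)" "\<lambda>(a, b). (- a, - b)"])
    fix z assume "z \<in> ?S 2"
    then show "(case z of (a, b) \<Rightarrow> (- a, - b)) \<in> ?S 1" 
      by (cases z) (auto, presburger)
    show "hecke (case z of (a, b) \<Rightarrow> (- a, - b)) = hecke z"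
      using hecke_scale[of "- 1" z] by (cases z) (simp add: chi3_def)
  next
    fix z assume "z \<in> ?S 1"
    then show "(case z of (a, b) \<Rightarrow> (- a, - b)) \<in> ?S 2"
      by (cases z) (auto, presburger)
  qed auto
  also have "sum hecke (?S 1) = sum trace_cube (?S 1)"
    by (rule sum.cong) (auto simp: hecke_def chi3_def)
  finally show ?thesis by simp
qed

section \<open>Conclusion\<close>

text \<open>X-adic convergence means that each coefficient is eventually constant. Nonzero factors
  exclude the case of \<open>has_prod\<close> in which the product is 0 by a vanishing
  factor.\<close>

lemma has_prod_eq_upto:
  fixes f :: "nat \<Rightarrow> rat fps"
  assumes "f has_prod L" "\<And>n. f n \<noteq> 0"
  obtains m where "m \<ge> K" "fps_eq_upto K (\<Prod>i\<le>m. f i) L"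
proof -
  have "raw_has_prod f 0 L" using assms unfolding has_prod_def by metis
  then have "(\<lambda>m. \<Prod>i\<le>m. f i) \<longlonglongrightarrow> L" by (simp add: raw_has_prod_def)
  then have "\<forall>\<^sub>F m in sequentially. fps_nth (\<Prod>i\<le>m. f i) k = fps_nth L k" for k
    by (simp add: tendsto_fps_iff)
  then have "\<forall>\<^sub>F m in sequentially. \<forall>k\<in>{..<K}. fps_nth (\<Prod>i\<le>m. f i) k = fps_nth L k"
    by (intro eventually_ball_finite) auto
  then obtain M where "\<forall>m\<ge>M. \<forall>k\<in>{..<K}. fps_nth (\<Prod>i\<le>m. f i) k = fps_nth L k"
    unfolding eventually_sequentially by blast
  then show thesis
    using that[of "max M K"] by (simp add: fps_eq_upto_def)
qed

lemma one_minus_X_power_nonzero: "1 - fps_X ^ (d * Suc n) \<noteq> (0 :: rat fps)" if "d > 0"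
proof
  assume "1 - fps_X ^ (d * Suc n) = (0 :: rat fps)"
  then have "fps_nth (1 - fps_X ^ (d * Suc n)) 0 = (0 :: rat)" by simp
  then show False using that by simp
qed

lemma prodinf_eta_power_8: "(\<Prod>n. (1 - fps_X ^ Suc n) ^ 8) = euler_fps 1 ^ 8"
proof (rule fps_eqI_upto)
  fix K :: nat
  let ?f = "\<lambda>n. (1 - fps_X ^ Suc n :: rat fps) ^ 8"
  obtain c :: "nat \<Rightarrow> int" where c: "?f has_prod Abs_fps (\<lambda>n. of_int (c n))"
    using eta_power_8_has_prod by blast
  then have "?f has_prod prodinf ?f"
    unfolding has_prod_unique[OF c] .
  moreover have "?f n \<noteq> 0" for n
    using one_minus_X_power_nonzero[of 1 n] by simp
  ultimately obtain m where m: "m \<ge> K" "fps_eq_upto K (\<Prod>i\<le>m. ?f i) (prodinf ?f)"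
    by (rule has_prod_eq_upto)
  have prod_f: "(\<Prod>i\<le>m. ?f i) = euler_prod 1 (Suc m) ^ 8"
    by (simp add: euler_prod_def prod_power_distrib lessThan_Suc_atMost)
  have "fps_eq_upto K (prodinf ?f) (euler_prod 1 (Suc m) ^ 8)"
    using fps_eq_upto_sym[OF m(2)] unfolding prod_f .
  also have "fps_eq_upto K (euler_prod 1 (Suc m) ^ 8) (euler_fps 1 ^ 8)"
    using m(1) by (intro fps_eq_upto_power euler_prod_eq_upto) simp_all
  finally show "fps_eq_upto K (prodinf ?f) (euler_fps 1 ^ 8)" .
qed

text \<open>Multiplication by \<open>euler_fps 1\<close> clears the denominators and leaves
  \<open>euler_fps 3 ^ 3\<close>, to which \<open>three_core_series\<close> applies; then
  \<open>euler_fps 1\<close> is cancelled.\<close>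

lemma prodinf_three_core:
  "(\<Prod>n. (1 - fps_X ^ (3 * Suc n)) ^ 3 / (1 - fps_X ^ Suc n)) = qsum (\<lambda>_. 1) three_core_exp"
proof -
  let ?f = "\<lambda>n. (1 - fps_X ^ (3 * Suc n)) ^ 3 / (1 - fps_X ^ Suc n) :: rat fps"
  have f: "?f n * (1 - fps_X ^ Suc n) = (1 - fps_X ^ (3 * Suc n)) ^ 3" for n
  proof -
    have "fps_nth (1 - fps_X ^ Suc n) 0 = (1 :: rat)" by simp
    then show ?thesis
      by (simp add: fps_divide_unit mult.assoc inverse_mult_eq_1 del: power_Suc)
  qed
  have prod_f: "(\<Prod>i\<le>m. ?f i) * euler_prod 1 (Suc m) = euler_prod 3 (Suc m) ^ 3" for m
  proof -
    have "(\<Prod>i\<le>m. ?f i) * euler_prod 1 (Suc m) = (\<Prod>i\<le>m. ?f i * (1 - fps_X ^ Suc i))"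
      unfolding euler_prod_def lessThan_Suc_atMost prod.distrib mult_1 ..
    then show ?thesis
      unfolding f by (simp only: euler_prod_def lessThan_Suc_atMost prod_power_distrib)
  qed
  have "prodinf ?f * euler_fps 1 = euler_fps 3 ^ 3"
  proof (rule fps_eqI_upto)
    fix K :: nat
    obtain c :: "nat \<Rightarrow> int" where c: "?f has_prod Abs_fps (\<lambda>n. of_int (c n))"
      using three_core_has_prod by blast
    then have "?f has_prod prodinf ?f"
      unfolding has_prod_unique[OF c] .
    moreover have "?f n \<noteq> 0" for n
    proof
      assume 0: "?f n = 0"
      have "(1 - fps_X ^ (3 * Suc n) :: rat fps) ^ 3 = ?f n * (1 - fps_X ^ Suc n)"
        by (rule f[symmetric])
      also have "\<dots> = 0" unfolding 0 by (rule mult_zero_left)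
      finally show False using one_minus_X_power_nonzero[of 3 n] by (simp only: power_eq_0_iff) simp
    qed
    ultimately obtain m where m: "m \<ge> K" "fps_eq_upto K (\<Prod>i\<le>m. ?f i) (prodinf ?f)"
      by (rule has_prod_eq_upto)
    have "fps_eq_upto K (prodinf ?f * euler_fps 1) ((\<Prod>i\<le>m. ?f i) * euler_prod 1 (Suc m))"
      using m by (intro fps_eq_upto_mult fps_eq_upto_sym[OF m(2)] fps_eq_upto_sym[OF euler_prod_eq_upto]) simp_all
    also have "fps_eq_upto K ((\<Prod>i\<le>m. ?f i) * euler_prod 1 (Suc m)) (euler_fps 3 ^ 3)"
      unfolding prod_f using m(1) by (intro fps_eq_upto_power euler_prod_eq_upto) simp_all
    finally show "fps_eq_upto K (prodinf ?f * euler_fps 1) (euler_fps 3 ^ 3)" .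
  qed
  then have "prodinf ?f * euler_fps 1 = qsum (\<lambda>_. 1) three_core_exp * euler_fps 1"
    unfolding three_core_series by (simp only: mult.commute)
  moreover have "euler_fps 1 \<noteq> 0" using euler_fps_nth_0[of 1] by auto
  ultimately show ?thesis using mult_right_cancel by blast
qed

section \<open>Coefficients in terms of norms\<close>

text \<open>The argument on the left is the general element congruent to 1 modulo 3.\<close>

lemma three_core_exp_enorm: "enorm (3 * m + 1, - 3 * n) = 3 * int (three_core_exp (m, n)) + 1"
proof -
  have "2 * int (three_core_exp (m, n)) = 2 * int (theta_exp 3 0 m) +
      (2 * int (theta_exp 2 1 n) + 2 * int (theta_exp 1 2 (- m - n)))" by simp
  then have "2 * int (three_core_exp (m, n)) = 6 * (m * m) + 6 * (m * n) + 6 * (n * n) + 4 * m + 2 * n"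
    unfolding two_theta_exp by (simp add: algebra_simps power2_eq_square)
  then show ?thesis by (simp add: algebra_simps power2_eq_square)
qed

text \<open>An element of norm prime to 3 can be moved into the class of 1 modulo 3 without changing
  its norm, and there \<open>three_core_exp_enorm\<close> can be read backwards.\<close>

lemma ex_three_core_exp_iff:
  "(\<exists>x. three_core_exp x = n) \<longleftrightarrow> (\<exists>z. enorm z = int (3 * n + 1))"
proof
  assume "\<exists>x. three_core_exp x = n"
  then obtain k l where kl: "three_core_exp (k, l) = n" by auto
  have "enorm (3 * k + 1, - 3 * l) = int (3 * n + 1)"
    unfolding three_core_exp_enorm kl by simp
  then show "\<exists>z. enorm z = int (3 * n + 1)" by blast
next
  assume "\<exists>z. enorm z = int (3 * n + 1)"
  then obtain a b where ab: "enorm (a, b) = int (3 * n + 1)" by auto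
  then have "((a + b) * (a + b)) mod 3 = 1" using enorm_mod_3[OF ab] by simp
  then have s: "(a + b) mod 3 \<noteq> 0" by auto
  let ?P = "\<lambda>c d. enorm (c, d) = int (3 * n + 1) \<and> c mod 3 = 1 \<and> d mod 3 = 0"
  \<comment> \<open>Multiply by a unit, or conjugate.\<close>
  have e: "enorm (- a, - b) = enorm (a, b)" "enorm (b, a) = enorm (a, b)" "enorm (- b, - a) = enorm (a, b)"
    "enorm (a, a - b) = enorm (a, b)" "enorm (- a, b - a) = enorm (a, b)"
    by (simp_all add: algebra_simps power2_eq_square)
  have "a mod 3 = 1 \<and> b mod 3 = 0 \<or> (- a) mod 3 = 1 \<and> (- b) mod 3 = 0 \<or>
      b mod 3 = 1 \<and> a mod 3 = 0 \<or> (- b) mod 3 = 1 \<and> (- a) mod 3 = 0 \<or>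
      a mod 3 = 1 \<and> (a - b) mod 3 = 0 \<or> (- a) mod 3 = 1 \<and> (b - a) mod 3 = 0"
    using s by presburger
  then have "?P a b \<or> ?P (- a) (- b) \<or> ?P b a \<or> ?P (- b) (- a) \<or> ?P a (a - b) \<or> ?P (- a) (b - a)"
    unfolding e ab by simp
  then have "\<exists>c d. ?P c d" by (elim disjE) (rule exI, rule exI, assumption)+
  then obtain c d where cd: "?P c d" by (elim exE)
  then have "c = 3 * (c div 3) + 1" "d = - 3 * (- d div 3)" by presburger+
  then have "int (3 * n + 1) = 3 * int (three_core_exp (c div 3, - d div 3)) + 1"
    using three_core_exp_enorm cd by metis
  then have "three_core_exp (c div 3, - d div 3) = n" by simp
  then show "\<exists>x. three_core_exp x = n" by blast
qed

lemma qsum_three_core_nonzero_iff: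
  "fps_nth (qsum (\<lambda>_. 1) three_core_exp) n \<noteq> 0 \<longleftrightarrow> (\<exists>z. enorm z = int (3 * n + 1))"
proof -
  have "finite {x. three_core_exp x = n}"
  proof (rule finite_subset)
    show "{x. three_core_exp x = n} \<subseteq> {m. theta_exp 3 0 m \<le> n} \<times> {m. theta_exp 2 1 m \<le> n}" by auto
  qed (intro finite_cartesian_product finite_theta_exp; simp)
  then have "fps_nth (qsum (\<lambda>_. 1) three_core_exp) n \<noteq> 0 \<longleftrightarrow> (\<exists>x. three_core_exp x = n)"
    by (simp add: qsum_nth)
  then show ?thesis unfolding ex_three_core_exp_iff .
qed

text \<open>The factor 12 is the 6 of \<open>macdonald_A2\<close> times the 2 of
  \<open>hecke_sum_eq_trace_sum\<close>.\<close>

lemma eta_power_8_hecke_sum: "12 * fps_nth (euler_fps 1 ^ 8) n = of_int (hecke_sum (3 * n + 1))"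
proof -
  let ?S = "{z. (fst z + snd z) mod 3 = 1 \<and> enorm z = int (3 * n + 1)}"
  have S: "z \<in> ?S \<longleftrightarrow> (fst z + snd z) mod 3 = 1 \<and> norm_exp z = n" for z
    using norm_exp_eq_iff[of "fst z" "snd z" n] by auto
  have "6 * fps_nth (euler_fps 1 ^ 8) n = fps_nth (fps_const 6 * euler_fps 1 ^ 8) n" by simp
  also have "\<dots> = sum (trace_part 1) ?S"
    unfolding macdonald_A2
  proof (rule qsum_nth')
    show "finite ?S" by (rule finite_subset[OF _ finite_enorm_eq]) auto
    show "z \<in> ?S" if "trace_part 1 z \<noteq> 0" "norm_exp z = n" for z
      unfolding S using that by (simp add: trace_part_def split: if_splits)
    show "norm_exp z = n" if "z \<in> ?S" for z using that unfolding S by blast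
  qed
  also have "\<dots> = of_int (sum trace_cube ?S)"
    by (simp add: trace_part_def)
  finally show ?thesis unfolding hecke_sum_eq_trace_sum by simp
qed

theorem theorem1p1:
  fixes a b :: "nat \<Rightarrow> int"
  assumes "Abs_fps (\<lambda>n. rat_of_int (a n)) = (\<Prod>n. (1 - fps_X ^ Suc n) ^ 8)"
    and "Abs_fps (\<lambda>n. rat_of_int (b n)) =
      (\<Prod>n. (1 - fps_X ^ (3 * Suc n)) ^ 3 / (1 - fps_X ^ Suc n))"
  shows "(\<forall>n. a n = 0 \<longleftrightarrow> b n = 0) \<and>
    (\<forall>n. (a n = 0 \<and> b n = 0) \<longleftrightarrow>
      (\<exists>p::nat. prime p \<and> [p = 2] (mod 3) \<and> odd (multiplicity p (3 * n + 1))))"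
proof -
  define Q where "Q n \<longleftrightarrow> (\<exists>p::nat. prime p \<and> [p = 2] (mod 3) \<and> odd (multiplicity p (3 * n + 1)))" for n
  have a: "12 * a n = hecke_sum (3 * n + 1)" for n
  proof -
    have "rat_of_int (a n) = fps_nth (euler_fps 1 ^ 8) n"
      using assms(1) unfolding prodinf_eta_power_8 by (metis fps_nth_Abs_fps)
    then have "rat_of_int (12 * a n) = of_int (hecke_sum (3 * n + 1))"
      using eta_power_8_hecke_sum[of n] by simp
    then show ?thesis by (simp only: of_int_eq_iff)
  qed
  have b: "b n \<noteq> 0 \<longleftrightarrow> (\<exists>z. enorm z = int (3 * n + 1))" for n
  proof -
    have "rat_of_int (b n) = fps_nth (qsum (\<lambda>_. 1) three_core_exp) n"
      using assms(2) unfolding prodinf_three_core by (metis fps_nth_Abs_fps)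
    then show ?thesis using qsum_three_core_nonzero_iff[of n] by (metis of_int_eq_0_iff)
  qed
  have "a n = 0 \<and> b n = 0" if "Q n" for n
  proof -
    from that obtain p where p: "prime p" "p mod 3 = 2" "odd (multiplicity p (3 * n + 1))"
      by (auto simp: Q_def cong_def)
    have none: "enorm z \<noteq> int (3 * n + 1)" for z
      using even_multiplicity_enorm[OF p(1,2), of z "3 * n + 1"] p(3) by auto
    then have "hecke_sum (3 * n + 1) = 0" unfolding hecke_sum_def by simp
    then show ?thesis using a[of n] b[of n] none by auto
  qed
  moreover have "a n \<noteq> 0 \<and> b n \<noteq> 0" if "\<not> Q n" for n
  proof -
    have "\<not> 3 dvd 3 * n + 1" by presburger
    moreover have "even (multiplicity p (3 * n + 1))" if "prime p" "p mod 3 = 2" for p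
      using that \<open>\<not> Q n\<close> by (auto simp: Q_def cong_def)
    ultimately have *: "hecke_sum (3 * n + 1) \<noteq> 0" by (intro hecke_sum_nonzero) auto
    \<comment> \<open>A nonzero sum has a nonempty index set, so the nonvanishing for
      \<open>a\<close> also settles \<open>b\<close>.\<close>
    then have "\<exists>z. enorm z = int (3 * n + 1)"
      unfolding hecke_sum_def by (metis (mono_tags, lifting) mem_Collect_eq sum.neutral)
    then show ?thesis using * a[of n] b[of n] by auto
  qed
  ultimately show ?thesis unfolding Q_def[symmetric] by blast
qed

end
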